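(* Let $B(n)=\binom{\lfloor (n-2)/2\rfloor}{2}+\binom{\lceil (n-2)/2\rceil}{2}$. There exists an integer $n_0$ such that for every $n\ge n_0$, $$g(n,P_3,P_4)=B(n).$$
   Context: $P_r$ denotes the path on $r$ vertices. For fixed graphs $H$ and $F$, the Constructor–Blocker game is played on the edge set of $K_n$: Constructor and Blocker alternately claim previously unclaimed edges, Constructor moving first. Constructor may only claim an edge if after claiming it his graph (all edges he has claimed) contains no copy of $F$ as a subgraph; Blocker may claim any unclaimed edge. The game ends when Constructor cannot claim a further edge or all edges are claimed. The score is the number of copies of $H$ (as subgraphs) all of whose edges were claimed by Constructor. Constructor maximizes, Blocker minimizes the score; $g(n,H,F)$ is the score under optimal play by both players. *)

theory Defs
  imports Complex_Main "HOL-Library.Ramsey"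
begin

(* A graph is a pair (vertex set, edge set); edges are two-element sets of vertices. *)
type_synonym 'a graph = "'a set \<times> 'a set set"

abbreviation verts :: "'a graph \<Rightarrow> 'a set" where "verts \<equiv> fst"

abbreviation edges :: "'a graph \<Rightarrow> 'a set set" where "edges \<equiv> snd"

definition simple_graph :: "'a graph \<Rightarrow> bool" where
  "simple_graph G \<longleftrightarrow> edges G \<subseteq> nsets (verts G) 2"

definition subgraph :: "'a graph \<Rightarrow> 'a graph \<Rightarrow> bool" where
  "subgraph S G \<longleftrightarrow> simple_graph S \<and> verts S \<subseteq> verts G \<and> edges S \<subseteq> edges G"

definition graph_iso :: "'a graph \<Rightarrow> 'b graph \<Rightarrow> bool" where
  "graph_iso H G \<longleftrightarrow> (\<exists>f. bij_betw f (verts H) (verts G) \<and>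
     (\<forall>u\<in>verts H. \<forall>v\<in>verts H. {u, v} \<in> edges H \<longleftrightarrow> {f u, f v} \<in> edges G))"

(* Copies are not necessarily induced, and are counted as subgraphs (not as embeddings). *)
definition copies :: "'a graph \<Rightarrow> 'b graph \<Rightarrow> 'b graph set" where
  "copies H G = {S. subgraph S G \<and> graph_iso H S}"

definition path_graph :: "nat \<Rightarrow> nat graph" where
  "path_graph r = ({..<r}, {{i, Suc i} | i. Suc i < r})"

definition complete_graph :: "nat \<Rightarrow> nat graph" where
  "complete_graph n = ({..<n}, nsets {..<n} 2)"

(* In a position (C, B), C is the set of edges claimed by Constructor and B the set of
   edges claimed by Blocker. *)
definition unclaimed :: "nat \<Rightarrow> nat set set \<Rightarrow> nat set set \<Rightarrow> nat set set" where
  "unclaimed n C B = edges (complete_graph n) - (C \<union> B)"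

definition constructor_moves ::
    "nat \<Rightarrow> 'b graph \<Rightarrow> nat set set \<Rightarrow> nat set set \<Rightarrow> nat set set" where
  "constructor_moves n F C B = {e \<in> unclaimed n C B. copies F ({..<n}, insert e C) = {}}"

definition game_over :: "nat \<Rightarrow> 'b graph \<Rightarrow> nat set set \<Rightarrow> nat set set \<Rightarrow> bool" where
  "game_over n F C B \<longleftrightarrow> constructor_moves n F C B = {} \<or> unclaimed n C B = {}"

definition score :: "nat \<Rightarrow> 'a graph \<Rightarrow> nat set set \<Rightarrow> nat" where
  "score n H C = card (copies H ({..<n}, C))"

(* Needed so that the recursive calls below are recorded as being made on available edges. *)
lemma image_fundef_cong [fundef_cong]:
  "M = N \<Longrightarrow> (\<And>x. x \<in> N \<Longrightarrow> f x = g x) \<Longrightarrow> f ` M = g ` N"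
  by (rule image_cong)

lemma card_unclaimed_insert:
  assumes "e \<in> unclaimed n C B"
  shows "card (unclaimed n (insert e C) B) < card (unclaimed n C B)"
    and "card (unclaimed n C (insert e B)) < card (unclaimed n C B)"
proof -
  have fin: "finite (unclaimed n C B)"
    by (simp add: unclaimed_def complete_graph_def finite_imp_finite_nsets)
  have "unclaimed n (insert e C) B \<subset> unclaimed n C B"
    and "unclaimed n C (insert e B) \<subset> unclaimed n C B"
    using assms by (auto simp: unclaimed_def)
  then show "card (unclaimed n (insert e C) B) < card (unclaimed n C B)"
    and "card (unclaimed n C (insert e B)) < card (unclaimed n C B)"
    using fin by (auto intro: psubset_card_mono)
qed

(* Minimax values: the final score under optimal play from the position (C, B), with
   Constructor to move and with Blocker to move, respectively. *)
function constructor_value ::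
      "nat \<Rightarrow> 'a graph \<Rightarrow> 'b graph \<Rightarrow> nat set set \<Rightarrow> nat set set \<Rightarrow> nat"
  and blocker_value ::
      "nat \<Rightarrow> 'a graph \<Rightarrow> 'b graph \<Rightarrow> nat set set \<Rightarrow> nat set set \<Rightarrow> nat"
where
  "constructor_value n H F C B =
     (if game_over n F C B then score n H C
      else Max ((\<lambda>e. blocker_value n H F (insert e C) B) ` constructor_moves n F C B))"
| "blocker_value n H F C B =
     (if game_over n F C B then score n H C
      else Min ((\<lambda>e. constructor_value n H F C (insert e B)) ` unclaimed n C B))"
  by pat_completeness auto
termination
  by (relation "measure (case_sum (\<lambda>(n, H, F, C, B). card (unclaimed n C B))
                                  (\<lambda>(n, H, F, C, B). card (unclaimed n C B)))")
     (auto simp: constructor_moves_def intro: card_unclaimed_insert)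

(* Non-terminating as rewrite rules. *)
declare constructor_value.simps [simp del] blocker_value.simps [simp del]

definition constructor_blocker :: "nat \<Rightarrow> 'a graph \<Rightarrow> 'b graph \<Rightarrow> nat" where
  "constructor_blocker n H F = constructor_value n H F {} {}"

end

theory Submission
  imports Defs
begin

text \<open>
  A graph without \<open>P\<^sub>4\<close> is a disjoint union of stars and triangles, and its number of copies of
  \<open>P\<^sub>3\<close> is the sum of \<open>d choose 2\<close> over all degrees \<open>d\<close>.

  Constructor fixes two centers and pairs the two edges joining any other vertex to them; he then
  ends up with two stars whose degrees add up to \<open>n - 2\<close>, and \<open>d choose 2\<close> is convex.

  Two stars whose degrees \<open>d \<ge> d'\<close> are close to \<open>n / 2\<close> score more than that only if they
  span all vertices and \<open>d > (n - 1) / 2\<close>: a single lost vertex costs about \<open>n / 2\<close> copies, while an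
  imbalance of bounded size gains only a constant. Blocker answers every extension of a star at its
  center, which keeps all degrees below \<open>n / 2 + O(1)\<close>. Once there are two stars of degree at least
  two with centers \<open>u\<close> and \<open>v\<close>, any isolated vertex \<open>x\<close> with \<open>{u, x}\<close> claimed by Blocker is lost
  when he claims \<open>{v, x}\<close> as well. If there is no such \<open>x\<close>, both stars are still small; Blocker then
  always claims an edge at the larger center, and Constructor must respond at the smaller one, so that
  the stars end up balanced.
\<close>

subsection \<open>Copies of short paths\<close>

definition nbrs :: "'a set set \<Rightarrow> 'a \<Rightarrow> 'a set" where
  "nbrs C v = {w. {v, w} \<in> C}"

definition deg :: "'a set set \<Rightarrow> 'a \<Rightarrow> nat" where
  "deg C v = card (nbrs C v)"

definition P4_free :: "'a set set \<Rightarrow> bool" where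
  "P4_free C \<longleftrightarrow> (\<forall>a b c d. {a, b} \<in> C \<longrightarrow> {b, c} \<in> C \<longrightarrow> {c, d} \<in> C \<longrightarrow> \<not> distinct [a, b, c, d])"

lemma mem_nbrs [simp]: "w \<in> nbrs C v \<longleftrightarrow> {v, w} \<in> C"
  by (simp add: nbrs_def)

lemma edge_on:
  assumes "C \<subseteq> nsets {..<n} 2" "{a, b} \<in> C"
  shows "a < n" "b < n" "a \<noteq> b"
  using assms by (auto simp: nsets_def card_2_iff doubleton_eq_iff subset_iff)

lemma nsets_2E:
  assumes "e \<in> nsets X 2"
  obtains a b where "e = {a, b}" "a \<noteq> b" "a \<in> X" "b \<in> X"
proof -
  have "card e = 2" "e \<subseteq> X" using assms by (auto simp: nsets_def)
  then show ?thesis using that by (auto simp: card_2_iff)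
qed

lemma nbrs_subset:
  assumes "C \<subseteq> nsets {..<n} 2"
  shows "nbrs C v \<subseteq> {..<n} - {v}"
proof
  fix w assume "w \<in> nbrs C v"
  then show "w \<in> {..<n} - {v}"
    using edge_on[OF assms, of v w] by auto
qed

lemma finite_nbrs:
  assumes "C \<subseteq> nsets {..<n::nat} 2"
  shows "finite (nbrs C v)"
  using nbrs_subset[OF assms] finite_subset by blast

lemma path_graph_3: "path_graph 3 = ({0, 1, 2}, {{0, 1}, {1, 2}})"
proof -
  have "{..<3::nat} = {0, 1, 2}" by auto
  moreover have "{{i, Suc i} |i. Suc i < 3} = {{0, 1}, {1, 2}}"
    by (auto simp: less_Suc_eq numeral_eq_Suc)
  ultimately show ?thesis by (simp add: path_graph_def)
qed

lemma path_graph_4: "path_graph 4 = ({0, 1, 2, 3}, {{0, 1}, {1, 2}, {2, 3}})"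
proof -
  have "{..<4::nat} = {0, 1, 2, 3}" by auto
  moreover have "{{i, Suc i} |i. Suc i < 4} = {{0, 1}, {1, 2}, {2, 3}}"
    by (auto simp: less_Suc_eq numeral_eq_Suc)
  ultimately show ?thesis by (simp add: path_graph_def)
qed

text \<open>\<open>graph_iso\<close> also matches non-edges, so the witness for a path in
  \<open>C\<close> has to be the subgraph with exactly the three path edges; chords present in
  \<open>C\<close> are left out of it.\<close>

lemma copies_P4_empty_iff:
  assumes "C \<subseteq> nsets {..<n} 2"
  shows "copies (path_graph 4) ({..<n}, C) = {} \<longleftrightarrow> P4_free C"
proof
  assume L: "copies (path_graph 4) ({..<n}, C) = {}"
  show "P4_free C"
    unfolding P4_free_def
  proof (intro allI impI notI)
    fix a b c d
    assume e: "{a, b} \<in> C" "{b, c} \<in> C" "{c, d} \<in> C" and dist: "distinct [a, b, c, d]"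
    let ?S = "({a, b, c, d}, {{a, b}, {b, c}, {c, d}})"
    define f where "f = (\<lambda>i::nat. if i = 0 then a else if i = 1 then b else if i = 2 then c else d)"
    have "subgraph ?S ({..<n}, C)"
      using e edge_on[OF assms e(1)] edge_on[OF assms e(2)] edge_on[OF assms e(3)]
      by (auto simp: subgraph_def simple_graph_def nsets_def card_2_iff)
    moreover have "graph_iso (path_graph 4) ?S"
      unfolding graph_iso_def path_graph_4
    proof (intro exI[of _ f] conjI)
      show "bij_betw f (verts ({0, 1, 2, 3}, {{0, 1}, {1, 2}, {2, 3}})) (verts ?S)"
        using dist by (auto simp: bij_betw_def inj_on_def f_def)
      show "\<forall>u\<in>verts ({0, 1, 2, 3}, {{0, 1}, {1, 2}, {2, 3}}).
            \<forall>v\<in>verts ({0, 1, 2, 3}, {{0, 1}, {1, 2}, {2, 3}}).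
            ({u, v} \<in> edges ({0, 1, 2, 3}, {{0, 1}, {1, 2}, {2, 3}})) = ({f u, f v} \<in> edges ?S)"
        using dist by (auto simp: f_def doubleton_eq_iff)
    qed
    ultimately show False using L by (auto simp: copies_def)
  qed
next
  assume R: "P4_free C"
  show "copies (path_graph 4) ({..<n}, C) = {}"
  proof (rule ccontr)
    assume "copies (path_graph 4) ({..<n}, C) \<noteq> {}"
    then obtain S where S: "subgraph S ({..<n}, C)" and "graph_iso (path_graph 4) S"
      by (auto simp: copies_def)
    then obtain f where f: "bij_betw f {0, 1, 2, 3::nat} (verts S)"
      and fe: "\<forall>u\<in>{0, 1, 2, 3}. \<forall>v\<in>{0, 1, 2, 3}.
         {u, v} \<in> {{0, 1}, {1, 2}, {2, 3}} \<longleftrightarrow> {f u, f v} \<in> edges S"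
      unfolding graph_iso_def path_graph_4 fst_conv snd_conv by blast
    have "{f 0, f 1} \<in> edges S" "{f 1, f 2} \<in> edges S" "{f 2, f 3} \<in> edges S"
      using fe[rule_format, of 0 1] fe[rule_format, of 1 2] fe[rule_format, of 2 3] by simp_all
    then have "{f 0, f 1} \<in> C" "{f 1, f 2} \<in> C" "{f 2, f 3} \<in> C"
      using S by (auto simp: subgraph_def)
    moreover have "distinct [f 0, f 1, f 2, f 3]"
      using f by (auto simp: bij_betw_def inj_on_def)
    ultimately show False using R unfolding P4_free_def by blast
  qed
qed

text \<open>Non-edges are preserved, so the two ends are not adjacent in \<open>S\<close> and
  exactly two edges remain. The explicit form exhibits the middle vertex \<open>v\<close>, by which
  copies are counted later.\<close>

lemma graph_iso_P3_iff:
  assumes "simple_graph S"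
  shows "graph_iso (path_graph 3) S \<longleftrightarrow>
    (\<exists>a v b. distinct [a, v, b] \<and> S = ({a, v, b}, {{a, v}, {v, b}}))"
proof
  assume "graph_iso (path_graph 3) S"
  then obtain f where f: "bij_betw f {0, 1, 2::nat} (verts S)"
    and fe: "\<forall>u\<in>{0, 1, 2}. \<forall>v\<in>{0, 1, 2}.
       {u, v} \<in> {{0, 1}, {1, 2}} \<longleftrightarrow> {f u, f v} \<in> edges S"
    unfolding graph_iso_def path_graph_3 fst_conv snd_conv by blast
  have dist: "distinct [f 0, f 1, f 2]"
    using f by (auto simp: bij_betw_def inj_on_def)
  have v: "verts S = {f 0, f 1, f 2}"
    using f by (auto simp: bij_betw_def)
  have "{f 0, f 1} \<in> edges S" "{f 1, f 2} \<in> edges S" "{f 0, f 2} \<notin> edges S"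
    using fe by (auto simp: doubleton_eq_iff)
  moreover have "edges S \<subseteq> {{f 0, f 1}, {f 1, f 2}, {f 0, f 2}}"
    using assms v unfolding simple_graph_def nsets_2_eq by (auto simp: insert_commute)
  ultimately have "edges S = {{f 0, f 1}, {f 1, f 2}}" by blast
  then show "\<exists>a v b. distinct [a, v, b] \<and> S = ({a, v, b}, {{a, v}, {v, b}})"
    using dist v by (metis prod.collapse)
next
  assume "\<exists>a v b. distinct [a, v, b] \<and> S = ({a, v, b}, {{a, v}, {v, b}})"
  then obtain a v b where dist: "distinct [a, v, b]" and S: "S = ({a, v, b}, {{a, v}, {v, b}})"
    by blast
  define f where "f = (\<lambda>i::nat. if i = 0 then a else if i = 1 then v else b)"
  show "graph_iso (path_graph 3) S"
    unfolding graph_iso_def path_graph_3 S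
  proof (intro exI[of _ f] conjI)
    show "bij_betw f (verts ({0, 1, 2}, {{0, 1}, {1, 2}})) (verts ({a, v, b}, {{a, v}, {v, b}}))"
      using dist by (auto simp: bij_betw_def inj_on_def f_def)
    show "\<forall>u\<in>verts ({0, 1, 2}, {{0, 1}, {1, 2}}). \<forall>w\<in>verts ({0, 1, 2}, {{0, 1}, {1, 2}}).
          ({u, w} \<in> edges ({0, 1, 2}, {{0, 1}, {1, 2}})) =
          ({f u, f w} \<in> edges ({a, v, b}, {{a, v}, {v, b}}))"
      using dist by (auto simp: f_def doubleton_eq_iff)
  qed
qed

text \<open>A copy is determined by its middle vertex together with an unordered pair of neighbours
  of that vertex, so \<open>g\<close> is a bijection from such data onto the copies.\<close>

lemma score_P3:
  assumes C: "C \<subseteq> nsets {..<n} 2"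
  shows "score n (path_graph 3) C = (\<Sum>v<n. deg C v choose 2)"
proof -
  define g where "g = (\<lambda>(v::nat, A). (insert v A, (\<lambda>a. {v, a}) ` A))"
  have "copies (path_graph 3) ({..<n}, C) = g ` (SIGMA v:{..<n}. nsets (nbrs C v) 2)"
    (is "?L = ?R")
  proof
    show "?L \<subseteq> ?R"
    proof
      fix S assume "S \<in> ?L"
      then have sub: "subgraph S ({..<n}, C)" and "graph_iso (path_graph 3) S"
        by (auto simp: copies_def)
      then obtain a v b where d: "distinct [a, v, b]" and S: "S = ({a, v, b}, {{a, v}, {v, b}})"
        using graph_iso_P3_iff[of S] by (auto simp: subgraph_def)
      have e: "{v, a} \<in> C" "{v, b} \<in> C" "v < n"
        using sub S by (auto simp: subgraph_def insert_commute)
      have "g (v, {a, b}) = S"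
        by (auto simp: g_def S)
      moreover have "(v, {a, b}) \<in> (SIGMA v:{..<n}. nsets (nbrs C v) 2)"
        using e d by (auto simp: nsets_def)
      ultimately show "S \<in> ?R" by (metis image_eqI)
    qed
    show "?R \<subseteq> ?L"
    proof
      fix S assume "S \<in> ?R"
      then obtain v A where v: "v < n" "A \<in> nsets (nbrs C v) 2" and S: "S = g (v, A)"
        by auto
      obtain a b where A: "A = {a, b}" "a \<noteq> b" "{v, a} \<in> C" "{v, b} \<in> C"
        using nsets_2E[OF v(2)] by (metis mem_nbrs)
      have ab: "a < n" "b < n" "a \<noteq> v" "b \<noteq> v"
        using edge_on[OF C A(3)] edge_on[OF C A(4)] by auto
      have S': "S = ({a, v, b}, {{a, v}, {v, b}})"
        using S A by (auto simp: g_def)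
      have "subgraph S ({..<n}, C)"
        using A ab v by (auto simp: S' subgraph_def simple_graph_def nsets_def insert_commute)
      moreover have "graph_iso (path_graph 3) S"
      proof (subst graph_iso_P3_iff)
        show "simple_graph S" using calculation by (simp add: subgraph_def)
        show "\<exists>a v b. distinct [a, v, b] \<and> S = ({a, v, b}, {{a, v}, {v, b}})"
          using S' A(2) ab by (intro exI[of _ a] exI[of _ v] exI[of _ b]) auto
      qed
      ultimately show "S \<in> ?L" by (simp add: copies_def)
    qed
  qed
  moreover have "inj_on g (SIGMA v:{..<n}. nsets (nbrs C v) 2)"
  proof (rule inj_onI, clarsimp)
    fix v A w A'
    assume a: "A \<in> nsets (nbrs C v) 2" "A' \<in> nsets (nbrs C w) 2" "g (v, A) = g (w, A')"
    obtain a b where A: "A = {a, b}" "a \<noteq> b" "{v, a} \<in> C" "{v, b} \<in> C"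
      using nsets_2E[OF a(1)] by (metis mem_nbrs)
    obtain a' b' where A': "A' = {a', b'}" "a' \<noteq> b'" "{w, a'} \<in> C" "{w, b'} \<in> C"
      using nsets_2E[OF a(2)] by (metis mem_nbrs)
    have ne: "v \<noteq> a" "v \<noteq> b" "w \<noteq> a'" "w \<noteq> b'"
      using edge_on(3)[OF C] A A' by blast+
    have eq: "{{v, a}, {v, b}} = {{w, a'}, {w, b'}}" and vs: "insert v A = insert w A'"
      using a(3) A A' by (auto simp: g_def)
    \<comment> \<open>The middle vertex is recovered as the only common point of the two
      edges.\<close>
    have "\<Inter>{{v, a}, {v, b}} = {v}" "\<Inter>{{w, a'}, {w, b'}} = {w}"
      using A A' ne by auto
    then have "v = w"
      using eq by (metis singleton_inject)
    moreover have "A = A'"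
      using vs ne A(1) A'(1) \<open>v = w\<close> by auto
    ultimately show "v = w \<and> A = A'" by simp
  qed
  ultimately have "score n (path_graph 3) C = card (SIGMA v:{..<n}. nsets (nbrs C v) 2)"
    by (simp add: score_def card_image)
  also have "\<dots> = (\<Sum>v<n. card (nsets (nbrs C v) 2))"
    by (rule card_SigmaI) (auto intro: finite_imp_finite_nsets finite_nbrs[OF C])
  also have "\<dots> = (\<Sum>v<n. deg C v choose 2)"
    by (simp add: card_nsets deg_def)
  finally show ?thesis .
qed

subsection \<open>Values of positions\<close>

lemma finite_nsets_lessThan: "C \<subseteq> nsets {..<n::nat} 2 \<Longrightarrow> finite C"
  by (meson finite_imp_finite_nsets finite_lessThan finite_subset)

lemma finite_unclaimed: "finite (unclaimed n C B)"
  by (simp add: unclaimed_def complete_graph_def finite_imp_finite_nsets)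

lemma unclaimed_iff: "e \<in> unclaimed n C B \<longleftrightarrow> e \<in> nsets {..<n} 2 \<and> e \<notin> C \<and> e \<notin> B"
  by (simp add: unclaimed_def complete_graph_def)

lemma constructor_moves_subset: "constructor_moves n F C B \<subseteq> unclaimed n C B"
  by (auto simp: constructor_moves_def)

lemma constructor_moves_P4_iff:
  assumes "C \<subseteq> nsets {..<n} 2"
  shows "e \<in> constructor_moves n (path_graph 4) C B \<longleftrightarrow>
    e \<in> unclaimed n C B \<and> P4_free (insert e C)"
  using copies_P4_empty_iff[of "insert e C" n] assms
  by (auto simp: constructor_moves_def unclaimed_iff)

lemma score_mono:
  assumes "C \<subseteq> C'" "finite C'"
  shows "score n H C \<le> score n H C'"
proof -
  have "copies H ({..<n}, C') \<subseteq> Pow {..<n} \<times> Pow C'"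
    by (auto simp: copies_def subgraph_def)
  then have "finite (copies H ({..<n}, C'))"
    using assms by (meson finite_Pow_iff finite_SigmaI finite_lessThan finite_subset)
  moreover have "copies H ({..<n}, C) \<subseteq> copies H ({..<n}, C')"
    using assms by (auto simp: copies_def subgraph_def)
  ultimately show ?thesis
    by (simp add: score_def card_mono)
qed

text \<open>Claimed edges are never released, so the score already reached stays guaranteed. The two
  values call each other, hence one joint induction on the number of unclaimed edges.\<close>

lemma score_le_values:
  assumes "C \<subseteq> nsets {..<n} 2"
  shows "score n H C \<le> constructor_value n H F C B \<and> score n H C \<le> blocker_value n H F C B"
  using assms
proof (induction "card (unclaimed n C B)" arbitrary: C B rule: less_induct)
  case less
  have "score n H C \<le> constructor_value n H F C B"
  proof (cases "game_over n F C B")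
    case True
    then show ?thesis by (simp add: constructor_value.simps)
  next
    case False
    let ?f = "\<lambda>e. blocker_value n H F (insert e C) B"
    obtain e where e: "e \<in> constructor_moves n F C B"
      using False by (auto simp: game_over_def)
    then have u: "e \<in> unclaimed n C B"
      using constructor_moves_subset by blast
    have "score n H C \<le> score n H (insert e C)"
      using less.prems by (intro score_mono) (auto simp: finite_nsets_lessThan)
    also have "\<dots> \<le> ?f e"
      using less.hyps[of "insert e C" B] card_unclaimed_insert(1)[OF u] u less.prems
      by (auto simp: unclaimed_iff)
    also have "\<dots> \<le> Max (?f ` constructor_moves n F C B)"
      using e by (intro Max_ge)
        (auto intro: finite_subset[OF constructor_moves_subset finite_unclaimed])
    finally show ?thesis
      using False by (subst constructor_value.simps) simp
  qed
  moreover have "score n H C \<le> blocker_value n H F C B"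
  proof (cases "game_over n F C B")
    case True
    then show ?thesis by (simp add: blocker_value.simps)
  next
    case False
    let ?f = "\<lambda>e. constructor_value n H F C (insert e B)"
    have "score n H C \<le> Min (?f ` unclaimed n C B)"
      using False less.prems less.hyps[OF card_unclaimed_insert(2)]
      by (auto simp: finite_unclaimed game_over_def)
    then show ?thesis
      using False by (subst blocker_value.simps) simp
  qed
  ultimately show ?case by blast
qed

lemma blocker_value_le_constructor_value:
  assumes "e \<in> constructor_moves n F C B"
  shows "blocker_value n H F (insert e C) B \<le> constructor_value n H F C B"
proof -
  have "\<not> game_over n F C B"
    using assms constructor_moves_subset[of n F C B] by (auto simp: game_over_def)
  moreover have "blocker_value n H F (insert e C) B \<le>
      Max ((\<lambda>e. blocker_value n H F (insert e C) B) ` constructor_moves n F C B)"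
    using assms by (intro Max_ge)
      (auto intro: finite_subset[OF constructor_moves_subset finite_unclaimed])
  ultimately show ?thesis
    by (subst constructor_value.simps) simp
qed

text \<open>Strategy rule for Constructor: \<open>I\<close> describes positions with Blocker to
  move, and every move of his has an answer that restores \<open>I\<close> until the target
  \<open>K\<close> is reached. Asking for a legal Constructor move as well ensures that the game is
  not over yet.\<close>

lemma blocker_value_geI:
  assumes "I C B"
    and on: "\<And>C B. I C B \<Longrightarrow> C \<subseteq> nsets {..<n} 2"
    and step: "\<And>C B. I C B \<Longrightarrow> K \<le> score n H C \<or> constructor_moves n F C B \<noteq> {} \<and>
      (\<forall>f\<in>unclaimed n C B. \<exists>e\<in>constructor_moves n F C (insert f B). I (insert e C) (insert f B))"
  shows "K \<le> blocker_value n H F C B"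
  using assms(1)
proof (induction "card (unclaimed n C B)" arbitrary: C B rule: less_induct)
  case less
  show ?case
  proof (cases "K \<le> score n H C")
    case True
    then show ?thesis
      using score_le_values[OF on[OF less.prems], of H F B] by linarith
  next
    case False
    then have ne: "constructor_moves n F C B \<noteq> {}" and
      reply: "\<And>f. f \<in> unclaimed n C B \<Longrightarrow>
        \<exists>e\<in>constructor_moves n F C (insert f B). I (insert e C) (insert f B)"
      using step[OF less.prems] by blast+
    have "K \<le> constructor_value n H F C (insert f B)" if f: "f \<in> unclaimed n C B" for f
    proof -
      obtain e where e: "e \<in> constructor_moves n F C (insert f B)"
        and I: "I (insert e C) (insert f B)"
        using reply[OF f] by blast
      have "card (unclaimed n (insert e C) (insert f B)) < card (unclaimed n C B)"
        using card_unclaimed_insert(1)[of e n C "insert f B"] card_unclaimed_insert(2)[OF f] e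
          constructor_moves_subset by (meson less_trans subsetD)
      then have "K \<le> blocker_value n H F (insert e C) (insert f B)"
        using less.hyps I by blast
      also have "\<dots> \<le> constructor_value n H F C (insert f B)"
        using blocker_value_le_constructor_value[OF e] .
      finally show ?thesis .
    qed
    moreover have "\<not> game_over n F C B" "unclaimed n C B \<noteq> {}"
      using ne constructor_moves_subset[of n F C B] by (auto simp: game_over_def)
    ultimately show ?thesis
      by (subst blocker_value.simps) (simp add: finite_unclaimed)
  qed
qed

text \<open>A spare move never hurts Blocker, so a strategy for him may also pass.\<close>

lemma constructor_value_leI:
  assumes "I C B"
    and score: "\<And>C B. I C B \<Longrightarrow> score n H C \<le> K"
    and mono: "\<And>C B f. I C B \<Longrightarrow> f \<in> unclaimed n C B \<Longrightarrow> I C (insert f B)"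
    and step: "\<And>C B e. I C B \<Longrightarrow> e \<in> constructor_moves n F C B \<Longrightarrow>
      I (insert e C) B \<or> (\<exists>f\<in>unclaimed n (insert e C) B. I (insert e C) (insert f B))"
  shows "constructor_value n H F C B \<le> K"
  using assms(1)
proof (induction "card (unclaimed n C B)" arbitrary: C B rule: less_induct)
  case less
  show ?case
  proof (cases "game_over n F C B")
    case True
    then show ?thesis
      using score[OF less.prems] by (simp add: constructor_value.simps)
  next
    case False
    have "blocker_value n H F (insert e C) B \<le> K" if e: "e \<in> constructor_moves n F C B" for e
    proof (cases "game_over n F (insert e C) B")
      case True
      \<comment> \<open>The score depends on \<open>C\<close> alone, so the invariant bounds it even
        if it only holds after a reply that is never played.\<close>
      have "\<exists>B'. I (insert e C) B'"
        using step[OF less.prems e] by blast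
      then show ?thesis
        using True score by (auto simp: blocker_value.simps)
    next
      case False
      then have "unclaimed n (insert e C) B \<noteq> {}"
        by (simp add: game_over_def)
      then obtain f where f: "f \<in> unclaimed n (insert e C) B" "I (insert e C) (insert f B)"
        using step[OF less.prems e] mono by blast
      have "e \<in> unclaimed n C B"
        using e constructor_moves_subset by blast
      then have "card (unclaimed n (insert e C) (insert f B)) < card (unclaimed n C B)"
        using card_unclaimed_insert(1) card_unclaimed_insert(2)[OF f(1)] less_trans by blast
      then have "constructor_value n H F (insert e C) (insert f B) \<le> K"
        using less.hyps f(2) by blast
      moreover have "Min ((\<lambda>f. constructor_value n H F (insert e C) (insert f B)) `
          unclaimed n (insert e C) B) \<le> constructor_value n H F (insert e C) (insert f B)"
        using f(1) by (intro Min_le) (auto simp: finite_unclaimed)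
      ultimately show ?thesis
        using False by (subst blocker_value.simps) simp
    qed
    moreover have "finite (constructor_moves n F C B)" "constructor_moves n F C B \<noteq> {}"
      using False finite_subset[OF constructor_moves_subset[of n F C B] finite_unclaimed]
      by (simp_all add: game_over_def)
    ultimately show ?thesis
      using False by (subst constructor_value.simps) simp
  qed
qed

subsection \<open>Constructor's strategy\<close>

text \<open>For \<open>n\<close> at least 2, \<open>(n - 1) div 2\<close> is the ceiling of
  \<open>(n - 2) / 2\<close>, so this is \<open>B(n)\<close> in natural arithmetic.\<close>

definition two_star_value :: "nat \<Rightarrow> nat" where
  "two_star_value n = ((n - 2) div 2 choose 2) + ((n - 1) div 2 choose 2)"

lemma two_choose_two: "2 * (d choose 2) = d * (d - 1)"
  by (cases d) (auto simp: choose_two)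

text \<open>Convexity: for fixed \<open>a + b\<close> the right-hand side grows with the square of
  \<open>a - b\<close>, and the balanced split has the least difference that parity permits.\<close>

lemma two_star_value_le:
  assumes "a + b = n - 2" "2 \<le> n"
  shows "two_star_value n \<le> (a choose 2) + (b choose 2)"
proof -
  define k where "k = n - 2"
  have n: "n - 2 = k" "n - 1 = Suc k" "a + b = k"
    using assms by (auto simp: k_def)
  define c where "c = k div 2"
  define d where "d = Suc k div 2"
  have cd: "c + d = k" "d = c \<or> d = Suc c"
    unfolding c_def d_def by presburger+
  have i: "2 * int (x choose 2) = int x * int x - int x" for x
    using arg_cong[OF two_choose_two[of x], of int] by (cases x) (auto simp: algebra_simps)
  define s where "s = int a - int b"
  have ab: "2 * int a = int k + s" "2 * int b = int k - s"
    using n(3) by (auto simp: s_def)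
  have sq: "2 * (int a * int a + int b * int b) = int k * int k + s * s"
  proof -
    have "(2 * int a) * (2 * int a) + (2 * int b) * (2 * int b) = 2 * (int k * int k + s * s)"
      unfolding ab by (simp add: algebra_simps)
    then show ?thesis by simp
  qed
  have sqc: "2 * (int c * int c + int d * int d) = int k * int k + (int d - int c) * (int d - int c)"
    using cd by (auto simp: algebra_simps)
  have "(int d - int c) * (int d - int c) \<le> s * s"
  proof (cases "d = c")
    case False
    \<comment> \<open>\<open>s\<close> has the parity of \<open>k\<close>, which is odd in this
      case.\<close>
    then have "s \<noteq> 0" using cd ab by presburger
    then have "1 \<le> s * s" by (metis int_one_le_iff_zero_less not_square_less_zero mult_eq_0_iff linorder_neqE_linordered_idom)
    then show ?thesis using False cd(2) by auto
  qed simp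
  then have "2 * (int c * int c + int d * int d) \<le> 2 * (int a * int a + int b * int b)"
    unfolding sq sqc by simp
  then have "int c * int c + int d * int d \<le> int a * int a + int b * int b"
    by simp
  moreover have "int a + int b = int c + int d" using n(3) cd by simp
  ultimately have "int (c choose 2) + int (d choose 2) \<le> int (a choose 2) + int (b choose 2)"
    using i[of a] i[of b] i[of c] i[of d] by linarith
  then show ?thesis
    unfolding two_star_value_def n(1,2) c_def[symmetric] d_def[symmetric] by linarith
qed

lemma two_star_value_eq:
  assumes "2 \<le> n"
  shows "(nat \<lfloor>(real n - 2) / 2\<rfloor> choose 2) + (nat \<lceil>(real n - 2) / 2\<rceil> choose 2) = two_star_value n"
proof -
  have r: "real n - 2 = real_of_int (int n - 2)" by simp
  have "\<lfloor>(real n - 2) / 2\<rfloor> = (int n - 2) div 2"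
    unfolding r using floor_divide_of_int_eq[where ?'a=real, of "int n - 2" 2] by simp
  moreover have "\<lceil>(real n - 2) / 2\<rceil> = (int n - 1) div 2"
  proof -
    have "\<lceil>(real n - 2) / 2\<rceil> = - ((2 - int n) div 2)"
      using ceiling_divide_eq_div[where ?'a=real, of "int n - 2" 2] by simp
    also have "\<dots> = (int n - 1) div 2" by presburger
    finally show ?thesis .
  qed
  moreover have "nat ((int n - 2) div 2) = (n - 2) div 2" "nat ((int n - 1) div 2) = (n - 1) div 2"
    using assms by (auto simp: nat_div_distrib of_nat_diff nat_diff_distrib)
  ultimately show ?thesis by (simp add: two_star_value_def)
qed

text \<open>The centers are 0 and 1: whenever Blocker takes one of \<open>{0, w}\<close> and \<open>{1, w}\<close>,
  Constructor takes the other one.\<close>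

definition pairing_inv :: "nat \<Rightarrow> nat set set \<Rightarrow> nat set set \<Rightarrow> bool" where
  "pairing_inv n C B \<longleftrightarrow>
     (\<forall>e\<in>C. \<exists>i w. e = {i, w} \<and> i < 2 \<and> 2 \<le> w \<and> w < n) \<and>
     (\<forall>w. {0, w} \<notin> C \<or> {1, w} \<notin> C) \<and>
     (\<forall>w. 2 \<le> w \<longrightarrow> w < n \<longrightarrow> {0, w} \<notin> C \<longrightarrow> {1, w} \<notin> C \<longrightarrow> {0, w} \<notin> B \<and> {1, w} \<notin> B)"

lemma pairing_inv_subset:
  assumes "pairing_inv n C B"
  shows "C \<subseteq> nsets {..<n} 2"
proof
  fix e assume "e \<in> C"
  then obtain i w where "e = {i, w}" "i < 2" "2 \<le> w" "w < n"
    using assms unfolding pairing_inv_def by blast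
  then show "e \<in> nsets {..<n} 2" by (auto simp: nsets_def)
qed

text \<open>Every edge joins a center to a non-center, so one of the two inner vertices of a path on
  four vertices would be a non-center attached to both centers.\<close>

lemma pairing_inv_P4_free:
  assumes "pairing_inv n C B"
  shows "P4_free C"
  unfolding P4_free_def
proof (intro allI impI notI)
  fix a b c d
  assume e: "{a, b} \<in> C" "{b, c} \<in> C" "{c, d} \<in> C" and dist: "distinct [a, b, c, d]"
  have one: "x < 2 \<and> 2 \<le> y \<or> y < 2 \<and> 2 \<le> x" if "{x, y} \<in> C" for x y
    using assms that unfolding pairing_inv_def by (metis doubleton_eq_iff)
  have no: False if "{x, y} \<in> C" "{y, z} \<in> C" "x \<noteq> z" "2 \<le> y" for x y z
  proof -
    have "x < 2" "z < 2" using one[OF that(1)] one[OF that(2)] that(4) by auto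
    then have "{x, z} = {0, 1}" using that(3) by (auto simp: less_2_cases_iff)
    then have "{0, y} \<in> C \<and> {1, y} \<in> C"
      using that(1,2) by (auto simp: doubleton_eq_iff insert_commute)
    then show False using assms unfolding pairing_inv_def by blast
  qed
  show False
    using no[OF e(1,2)] no[OF e(2,3)] one[OF e(2)] dist by auto
qed

text \<open>Once every pair is settled, the neighbourhoods of the two centers partition
  \<open>{2..<n}\<close>, so their degrees add up to \<open>n - 2\<close> and convexity
  applies.\<close>

lemma pairing_inv_score:
  assumes I: "pairing_inv n C B" and n: "4 \<le> n"
    and all: "\<And>w. 2 \<le> w \<Longrightarrow> w < n \<Longrightarrow> {0, w} \<in> C \<or> {1, w} \<in> C"
  shows "two_star_value n \<le> score n (path_graph 3) C"
proof -
  note C = pairing_inv_subset[OF I]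
  have star: "w \<in> {2..<n}" if e: "{i, w} \<in> C" and "i < 2" for i w
  proof -
    have "\<exists>j v. {i, w} = {j, v} \<and> j < 2 \<and> 2 \<le> v \<and> v < n"
      using I e unfolding pairing_inv_def by blast
    then show ?thesis using that(2) by (auto simp: doubleton_eq_iff)
  qed
  have "nbrs C 0 \<union> nbrs C 1 \<subseteq> {2..<n}"
    using star[of 0] star[of 1] by auto
  moreover have "{2..<n} \<subseteq> nbrs C 0 \<union> nbrs C 1"
  proof
    fix w assume "w \<in> {2..<n}"
    then show "w \<in> nbrs C 0 \<union> nbrs C 1"
      using all[of w] by auto
  qed
  ultimately have "nbrs C 0 \<union> nbrs C 1 = {2..<n}"
    by blast
  moreover have "nbrs C 0 \<inter> nbrs C 1 = {}"
    using I by (auto simp: pairing_inv_def)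
  ultimately have "deg C 0 + deg C 1 = n - 2"
    unfolding deg_def using card_Un_disjoint[OF finite_nbrs[OF C] finite_nbrs[OF C], of 0 1] by simp
  then have "two_star_value n \<le> (deg C 0 choose 2) + (deg C 1 choose 2)"
    using two_star_value_le n by simp
  also have "\<dots> = (\<Sum>v\<in>{0, 1}. deg C v choose 2)" by simp
  also have "\<dots> \<le> (\<Sum>v<n. deg C v choose 2)"
    using n by (intro sum_mono2) auto
  finally show ?thesis by (simp add: score_P3[OF C])
qed

text \<open>Blocker's \<open>f\<close> may damage only the pair belonging to \<open>w\<close>, and
  that pair is settled at once by \<open>{i, w}\<close>; all other open pairs stay intact.\<close>

lemma pairing_inv_insert:
  assumes I: "pairing_inv n C B" and w: "2 \<le> w" "w < n" "{0, w} \<notin> C" "{1, w} \<notin> C"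
    and i: "i < 2" "{i, w} \<notin> insert f B"
    and f: "\<And>v. 2 \<le> v \<Longrightarrow> v < n \<Longrightarrow> v \<noteq> w \<Longrightarrow> {0, v} \<notin> C \<Longrightarrow> {1, v} \<notin> C \<Longrightarrow> f \<noteq> {0, v} \<and> f \<noteq> {1, v}"
  shows "pairing_inv n (insert {i, w} C) (insert f B)"
    and "{i, w} \<in> constructor_moves n (path_graph 4) C (insert f B)"
proof -
  have i2: "i = 0 \<or> i = 1" using i by auto
  show P: "pairing_inv n (insert {i, w} C) (insert f B)"
    unfolding pairing_inv_def
  proof (intro conjI allI ballI impI)
    fix e assume "e \<in> insert {i, w} C"
    then show "\<exists>i w. e = {i, w} \<and> i < 2 \<and> 2 \<le> w \<and> w < n"
      using I w i(1) unfolding pairing_inv_def by blast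
  next
    fix v
    have "{0, v} \<notin> C \<or> {1, v} \<notin> C" using I unfolding pairing_inv_def by blast
    then show "{0, v} \<notin> insert {i, w} C \<or> {1, v} \<notin> insert {i, w} C"
      using i2 w by (auto simp: doubleton_eq_iff)
  next
    fix v assume v: "2 \<le> v" "v < n" "{0, v} \<notin> insert {i, w} C" "{1, v} \<notin> insert {i, w} C"
    then have "v \<noteq> w" using i2 by auto
    then have "f \<noteq> {0, v} \<and> f \<noteq> {1, v}" using f v by auto
    moreover have "{0, v} \<notin> B \<and> {1, v} \<notin> B" using I v unfolding pairing_inv_def by blast
    ultimately show "{0, v} \<notin> insert f B" "{1, v} \<notin> insert f B" by auto
  qed
  have "{i, w} \<in> nsets {..<n} 2" using pairing_inv_subset[OF P] by blast
  moreover have "{i, w} \<notin> C" using i2 w by auto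
  ultimately show "{i, w} \<in> constructor_moves n (path_graph 4) C (insert f B)"
    using constructor_moves_P4_iff[OF pairing_inv_subset[OF I]] pairing_inv_P4_free[OF P] i(2)
    by (simp add: unclaimed_iff)
qed

text \<open>If \<open>f\<close> hits an open pair, its partner edge is the answer; otherwise any
  open vertex is joined to center 0. \<open>f\<close> is arbitrary, so that \<open>f = {}\<close>,
  which is no edge, can stand for the absence of a Blocker move.\<close>

lemma pairing_inv_reply:
  assumes I: "pairing_inv n C B" and ex: "\<exists>w. 2 \<le> w \<and> w < n \<and> {0, w} \<notin> C \<and> {1, w} \<notin> C"
  shows "\<exists>e\<in>constructor_moves n (path_graph 4) C (insert f B).
    pairing_inv n (insert e C) (insert f B)"
proof (cases "\<exists>w. 2 \<le> w \<and> w < n \<and> {0, w} \<notin> C \<and> {1, w} \<notin> C \<and> (f = {0, w} \<or> f = {1, w})")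
  case True
  then obtain w where w: "2 \<le> w" "w < n" "{0, w} \<notin> C" "{1, w} \<notin> C" "f = {0, w} \<or> f = {1, w}"
    by blast
  define i :: nat where "i = (if f = {0, w} then 1 else 0)"
  have B: "{0, w} \<notin> B" "{1, w} \<notin> B" using I w unfolding pairing_inv_def by blast+
  have "i < 2" "{i, w} \<notin> insert f B"
    using w B by (auto simp: i_def doubleton_eq_iff)
  moreover have "f \<noteq> {0, v} \<and> f \<noteq> {1, v}" if "2 \<le> v" "v \<noteq> w" for v
  proof -
    have "w \<in> f" using w(5) by blast
    moreover have "w \<notin> {0, v}" "w \<notin> {1, v}" using that w(1) by simp_all
    ultimately show ?thesis by blast
  qed
  ultimately show ?thesis
    using pairing_inv_insert[OF I w(1-4), of i f] by blast
next
  case False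
  then obtain w where w: "2 \<le> w" "w < n" "{0, w} \<notin> C" "{1, w} \<notin> C" "f \<noteq> {0, w}" "f \<noteq> {1, w}"
    using ex by blast
  have B: "{0, w} \<notin> B" using I w unfolding pairing_inv_def by blast
  have "{0, w} \<notin> insert f B" using B w(5) by simp
  moreover have "f \<noteq> {0, v} \<and> f \<noteq> {1, v}"
    if "2 \<le> v" "v < n" "{0, v} \<notin> C" "{1, v} \<notin> C" for v
    using False that by blast
  ultimately show ?thesis
    using pairing_inv_insert[OF I w(1-4) zero_less_numeral, of f] by blast
qed

lemma pairing_inv_value:
  assumes I: "pairing_inv n C B" and n: "4 \<le> n"
  shows "two_star_value n \<le> blocker_value n (path_graph 3) (path_graph 4) C B"
proof (rule blocker_value_geI[of "pairing_inv n", OF I])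
  show "C \<subseteq> nsets {..<n} 2" if "pairing_inv n C B" for C B
    using pairing_inv_subset[OF that] .
next
  fix C B assume I: "pairing_inv n C B"
  show "two_star_value n \<le> score n (path_graph 3) C \<or>
    constructor_moves n (path_graph 4) C B \<noteq> {} \<and>
    (\<forall>f\<in>unclaimed n C B. \<exists>e\<in>constructor_moves n (path_graph 4) C (insert f B).
       pairing_inv n (insert e C) (insert f B))"
  proof (cases "\<exists>w. 2 \<le> w \<and> w < n \<and> {0, w} \<notin> C \<and> {1, w} \<notin> C")
    case True
    \<comment> \<open>The void move \<open>{}\<close> turns the reply lemma into the existence of a
      legal move in the present position.\<close>
    moreover have "constructor_moves n (path_graph 4) C (insert {} B) \<subseteq>
        constructor_moves n (path_graph 4) C B"
      by (auto simp: constructor_moves_def unclaimed_def)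
    ultimately show ?thesis
      using pairing_inv_reply[OF I] by blast
  next
    case False
    then show ?thesis
      using pairing_inv_score[OF I n] by blast
  qed
qed

theorem constructor_blocker_ge:
  assumes n: "4 \<le> n"
  shows "two_star_value n \<le> constructor_blocker n (path_graph 3) (path_graph 4)"
proof -
  have "\<exists>w. 2 \<le> w \<and> w < n \<and> {0, w} \<notin> {} \<and> {1, w} \<notin> {}"
    using n by (intro exI[of _ 2]) auto
  moreover have "pairing_inv n {} {}"
    by (simp add: pairing_inv_def)
  \<comment> \<open>Constructor's opening is obtained as the reply to the void move
    \<open>{}\<close>.\<close>
  ultimately obtain e where e: "e \<in> constructor_moves n (path_graph 4) {} (insert {} {})"
    "pairing_inv n {e} (insert {} {})"
    using pairing_inv_reply[of n "{}" "{}" "{}"] by blast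
  have "e \<in> constructor_moves n (path_graph 4) {} {}"
    using e(1) by (auto simp: constructor_moves_def unclaimed_def)
  moreover have "pairing_inv n {e} {}"
    using e(2) unfolding pairing_inv_def by blast
  ultimately show ?thesis
    unfolding constructor_blocker_def
    using blocker_value_le_constructor_value pairing_inv_value[OF _ n] le_trans by blast
qed

subsection \<open>Scores of graphs without \<open>P\<^sub>4\<close>\<close>

text \<open>A walk of three edges that does not turn back must close up to a triangle: ends of edges
  differ, so \<open>a = d\<close> is the only coincidence left.\<close>

lemma P4_freeD:
  assumes "P4_free C" "C \<subseteq> nsets {..<n::nat} 2" "{a, b} \<in> C" "{b, c} \<in> C" "{c, d} \<in> C" "a \<noteq> c" "b \<noteq> d"
  shows "a = d"
proof (rule ccontr)
  assume "a \<noteq> d"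
  then have "distinct [a, b, c, d]"
    using edge_on(3)[OF assms(2)] assms(3-) by auto
  then show False using assms unfolding P4_free_def by blast
qed

lemma ex_nbr_avoiding:
  assumes "finite A" "card A < deg C v"
  shows "\<exists>w. {v, w} \<in> C \<and> w \<notin> A"
proof (rule ccontr)
  assume "\<not> ?thesis"
  then have "nbrs C v \<subseteq> A" by auto
  then show False using assms card_mono[of A "nbrs C v"] by (simp add: deg_def)
qed

text \<open>A second neighbour \<open>z\<close> of \<open>y\<close> would give the path
  \<open>w\<close>, \<open>x\<close>, \<open>y\<close>, \<open>z\<close>, where \<open>w\<close> is
  a neighbour of \<open>x\<close> other than \<open>y\<close> and \<open>z\<close>. Degree 3
  supplies this \<open>w\<close>; in a triangle there is none.\<close>

lemma nbrs_leaf: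
  assumes P: "P4_free C" and C: "C \<subseteq> nsets {..<n::nat} 2" and e: "{x, y} \<in> C" and d: "3 \<le> deg C x"
  shows "nbrs C y = {x}"
proof -
  have "z = x" if z: "{y, z} \<in> C" for z
  proof (rule ccontr)
    assume "z \<noteq> x"
    have "card {y, z} < deg C x" using d card_insert_le_m1[of 2 "{z}" y] by simp
    then obtain w where w: "{x, w} \<in> C" "w \<notin> {y, z}"
      using ex_nbr_avoiding[of "{y, z}" C x] by blast
    have "w = z"
      using P4_freeD[OF P C, of w x y z] w e z \<open>z \<noteq> x\<close> by (simp add: insert_commute)
    then show False using w by simp
  qed
  moreover have "{y, x} \<in> C" using e by (simp add: insert_commute)
  ultimately show ?thesis
    unfolding nbrs_def by blast
qed

text \<open>Such sets are unions of connected components, which is what remains after whole stars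
  have been removed.\<close>

definition closed_under :: "'a set set \<Rightarrow> 'a set \<Rightarrow> bool" where
  "closed_under C R \<longleftrightarrow> (\<forall>w\<in>R. nbrs C w \<subseteq> R)"

text \<open>A vertex of degree at least 3 and its leaves form an entire component, and leaves
  contribute nothing because \<open>1 choose 2\<close> is 0.\<close>

lemma remove_star:
  assumes P: "P4_free C" and C: "C \<subseteq> nsets {..<n::nat} 2"
    and R: "finite R" "closed_under C R" and v: "v \<in> R" "3 \<le> deg C v"
  defines "R' \<equiv> R - insert v (nbrs C v)"
  shows "closed_under C R'"
    and "(\<Sum>w\<in>R. deg C w choose 2) = (deg C v choose 2) + (\<Sum>w\<in>R'. deg C w choose 2)"
    and "card R = deg C v + 1 + card R'"
proof -
  let ?S = "insert v (nbrs C v)"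
  have leaf: "nbrs C w = {v}" if "w \<in> nbrs C v" for w
    using nbrs_leaf[OF P C _ v(2)] that by simp
  have SR: "?S \<subseteq> R" using R(2) v(1) by (auto simp: closed_under_def)
  have vn: "v \<notin> nbrs C v" using nbrs_subset[OF C] by blast
  have fin: "finite (nbrs C v)" using finite_nbrs[OF C] .
  show "closed_under C R'"
    unfolding closed_under_def
  proof (intro ballI subsetI)
    fix w z assume w: "w \<in> R'" and z: "z \<in> nbrs C w"
    have wz: "w \<in> nbrs C z" using z by (simp add: insert_commute)
    have "z \<in> R" using w z R(2) unfolding R'_def closed_under_def by blast
    moreover have "z \<noteq> v" using w wz by (auto simp: R'_def)
    moreover have "z \<notin> nbrs C v"
    proof
      assume "z \<in> nbrs C v"
      then have "w = v" using leaf[of z] wz by blast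
      then show False using w by (simp add: R'_def)
    qed
    ultimately show "z \<in> R'" by (simp add: R'_def)
  qed
  have "(\<Sum>w\<in>nbrs C v. deg C w choose 2) = 0"
    using leaf by (auto simp: deg_def)
  then have "(\<Sum>w\<in>?S. deg C w choose 2) = (deg C v choose 2)"
    using vn fin by simp
  then show "(\<Sum>w\<in>R. deg C w choose 2) = (deg C v choose 2) + (\<Sum>w\<in>R'. deg C w choose 2)"
    using sum.subset_diff[OF SR R(1), of "\<lambda>w. deg C w choose 2"] by (simp add: R'_def)
  have "card ?S = deg C v + 1" using vn fin by (simp add: deg_def)
  then show "card R = deg C v + 1 + card R'"
    using card_Diff_subset[of ?S R] card_mono[OF R(1) SR] fin SR by (simp add: R'_def)
qed

lemma choose_two_sum_small:
  assumes "finite R" "\<And>w. w \<in> R \<Longrightarrow> deg C w \<le> 2"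
  shows "(\<Sum>w\<in>R. deg C w choose 2) \<le> card R"
proof -
  have "deg C w choose 2 \<le> 1" if "w \<in> R" for w
    using assms(2)[OF that] by (auto simp: le_less_Suc_eq numeral_2_eq_2 le_Suc_eq)
  then show ?thesis using sum_bounded_above[of R "\<lambda>w. deg C w choose 2" 1] by simp
qed

text \<open>Each vertex accounts for at most \<open>y / 2\<close> copies on average. Stars are
  peeled off one by one: a star of degree \<open>d\<close> uses \<open>d + 1\<close> vertices and
  contributes \<open>d * (d - 1)\<close> to the doubled sum. What remains has degrees at most 2 and
  contributes at most one copy per vertex.\<close>

lemma choose_two_sum_le:
  assumes P: "P4_free C" and C: "C \<subseteq> nsets {..<n::nat} 2"
    and "finite R" "closed_under C R" "\<And>w. w \<in> R \<Longrightarrow> deg C w \<le> y" "2 \<le> y"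
  shows "2 * (\<Sum>w\<in>R. deg C w choose 2) \<le> card R * y"
  using assms(3-5)
proof (induction "card R" arbitrary: R rule: less_induct)
  case less
  show ?case
  proof (cases "\<exists>v\<in>R. 3 \<le> deg C v")
    case False
    then have "deg C w \<le> 2" if "w \<in> R" for w
      using that by force
    then have "(\<Sum>w\<in>R. deg C w choose 2) \<le> card R"
      using choose_two_sum_small[OF less.prems(1)] by blast
    also have "2 * card R \<le> card R * y"
      using assms(6) by simp
    finally show ?thesis by simp
  next
    case True
    then obtain v where v: "v \<in> R" "3 \<le> deg C v" by blast
    define R' where "R' = R - insert v (nbrs C v)"
    note rem = remove_star[OF P C less.prems(1,2) v, folded R'_def]
    have "2 * (\<Sum>w\<in>R'. deg C w choose 2) \<le> card R' * y"
      using less.hyps[of R'] rem less.prems by (auto simp: R'_def)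
    moreover have "2 * (deg C v choose 2) \<le> (deg C v + 1) * y"
      unfolding two_choose_two using less.prems(3)[OF v(1)] by (intro mult_mono) auto
    ultimately show ?thesis
      unfolding rem(2,3) by (simp add: algebra_simps)
  qed
qed

text \<open>The first bound is sharp for even \<open>n\<close> and off by 1 for odd
  \<open>n\<close>. The exact odd value serves the one extremal case without slack, a largest star
  of degree \<open>(n - 1) / 2\<close>.\<close>

lemma two_star_value_ge:
  assumes "3 \<le> n"
  shows "(int n - 2) * (int n - 4) \<le> 4 * int (two_star_value n)"
    and "n = 2 * k + 1 \<Longrightarrow> two_star_value n = (k - 1) * (k - 1)"
proof -
  have i: "2 * int (x choose 2) = int x * int x - int x" for x
    using arg_cong[OF two_choose_two[of x], of int] by (cases x) (auto simp: algebra_simps)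
  define c where "c = (n - 2) div 2"
  define d where "d = (n - 1) div 2"
  have cd: "d = c \<and> n = 2 * c + 2 \<or> d = Suc c \<and> n = 2 * c + 3"
    unfolding c_def d_def using assms by presburger
  have "2 * int (two_star_value n) = 2 * int (c choose 2) + 2 * int (d choose 2)"
    by (simp add: two_star_value_def c_def d_def)
  then have v: "2 * int (two_star_value n) = int c * int c - int c + (int d * int d - int d)"
    unfolding i .
  show "(int n - 2) * (int n - 4) \<le> 4 * int (two_star_value n)"
    using v cd by (auto simp: algebra_simps)
  assume "n = 2 * k + 1"
  then have c: "c = k - 1" and d: "d = Suc c" using cd assms by presburger+
  have "2 * int (two_star_value n) = 2 * int (c * c)"
    using v unfolding d by (simp add: algebra_simps)
  then have "two_star_value n = c * c" by linarith
  then show "two_star_value n = (k - 1) * (k - 1)"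
    using c by simp
qed

text \<open>The largest star has degree \<open>x\<close>, the largest one outside it degree
  \<open>y\<close>, and all remaining vertices are charged \<open>y / 2\<close> each. The hypothesis
  \<open>pair\<close> says that a star reaching half of the vertices never comes with a second one
  such that together they span everything.\<close>

lemma score_le_two_star_value:
  assumes P: "P4_free C" and C: "C \<subseteq> nsets {..<n} 2" and n: "100 \<le> n"
    and cap: "\<And>u. 2 * deg C u \<le> n + 5"
    and pair: "\<And>u v. u \<noteq> v \<Longrightarrow> 3 \<le> deg C u \<Longrightarrow> 3 \<le> deg C v \<Longrightarrow>
      2 * deg C u < n \<or> deg C u + deg C v + 3 \<le> n"
  shows "score n (path_graph 3) C \<le> two_star_value n"
proof -
  have val: "(int n - 2) * (int n - 4) \<le> 4 * int (two_star_value n)"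
    using two_star_value_ge(1) n by simp
  have large: "96 * int n - 192 \<le> 4 * int (two_star_value n)"
  proof -
    have "(int n - 2) * 96 \<le> (int n - 2) * (int n - 4)"
      using n by (intro mult_left_mono) auto
    then show ?thesis using val by simp
  qed
  define T where "T = (\<lambda>R. \<Sum>w\<in>R. deg C w choose 2)"
  have two: "\<not> 3 \<le> d \<Longrightarrow> d \<le> 2" for d :: nat by simp
  have cl: "closed_under C {..<n}"
    using nbrs_subset[OF C] by (auto simp: closed_under_def)
  have "T {..<n} \<le> two_star_value n"
  proof (cases "\<exists>u<n. 3 \<le> deg C u")
    case False
    then have "T {..<n} \<le> n"
      using choose_two_sum_small[of "{..<n}" C] two by (simp add: T_def)
    then show ?thesis using large n by linarith
  next
    case True
    define x where "x = Max (deg C ` {..<n})"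
    have "x \<in> deg C ` {..<n}"
      unfolding x_def using n by (intro Max_in) (auto simp: lessThan_empty_iff)
    then obtain u where u: "u < n" "deg C u = x" by auto
    have xmax: "deg C w \<le> x" if "w < n" for w
      unfolding x_def using that by (intro Max_ge) auto
    have x3: "3 \<le> x" using True xmax order_trans by blast
    define R where "R = {..<n} - insert u (nbrs C u)"
    have u': "u \<in> {..<n}" "3 \<le> deg C u" using u x3 by auto
    note rem = remove_star[OF P C finite_lessThan cl u', folded R_def, folded T_def]
    have finR: "finite R" by (simp add: R_def)
    have cR: "n = x + 1 + card R" using rem(3) u by simp
    have TR: "T {..<n} = (x choose 2) + T R" using rem(2) u by simp
    have xcap: "2 * x \<le> n + 5" using cap[of u] u by simp
    show ?thesis
    proof (cases "\<exists>v\<in>R. 3 \<le> deg C v")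
      case False
      \<comment> \<open>A single large star yields about \<open>n * n / 8\<close> copies and the
        rest at most \<open>n\<close>, while the target is about \<open>n * n / 4\<close>.\<close>
      then have "T R \<le> card R"
        using choose_two_sum_small[OF finR, of C] two by (auto simp: T_def)
      then have "2 * T {..<n} \<le> x * (x - 1) + 2 * n"
        using TR cR two_choose_two[of x] by linarith
      then have "8 * int (T {..<n}) \<le> 4 * int (x * (x - 1)) + 8 * int n" by linarith
      also have "4 * int (x * (x - 1)) = (2 * int x) * (2 * int x - 2)"
        using x3 by (simp add: of_nat_diff)
      also have "\<dots> \<le> (int n + 5) * (int n + 3)"
        using xcap x3 by (intro mult_mono) auto
      also have "(int n + 5) * (int n + 3) + 8 * int n \<le> 2 * ((int n - 2) * (int n - 4))"
      proof -
        have "100 * int n \<le> int n * int n" using n by (intro mult_right_mono) auto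
        then have "int n * 28 \<le> 1 + int n * int n" using n by linarith
        then show ?thesis by (simp add: algebra_simps)
      qed
      finally show ?thesis using val by linarith
    next
      case True
      define y where "y = Max (deg C ` R)"
      have "y \<in> deg C ` R"
        unfolding y_def using True finR by (intro Max_in) auto
      then obtain v where v: "v \<in> R" "deg C v = y" by auto
      have ymax: "deg C w \<le> y" if "w \<in> R" for w
        unfolding y_def using that finR by (intro Max_ge) auto
      have y3: "3 \<le> y" using True ymax order_trans by blast
      have v': "v \<in> R" "3 \<le> deg C v" using v y3 by auto
      define R' where "R' = R - insert v (nbrs C v)"
      note rem' = remove_star[OF P C finR rem(1) v', folded R'_def, folded T_def]
      have "2 * T R' \<le> card R' * y"
        unfolding T_def using y3 ymax rem'(1) finR
        by (intro choose_two_sum_le[OF P C]) (auto simp: R'_def)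
      then have TT: "2 * T {..<n} \<le> x * (x - 1) + y * (y - 1) + card R' * y"
      proof -
        have "2 * T {..<n} = 2 * (x choose 2) + 2 * (y choose 2) + 2 * T R'"
          using TR rem'(2) v(2) by simp
        then show ?thesis
          unfolding two_choose_two using \<open>2 * T R' \<le> card R' * y\<close> by simp
      qed
      have cR': "n = x + y + 2 + card R'" using cR rem'(3) v(2) by linarith
      have yx: "y \<le> x" using xmax v by (auto simp: R_def)
      have "u \<noteq> v" using v(1) by (auto simp: R_def)
      then have uv: "2 * x < n \<or> x + y + 3 \<le> n" using pair[of u v] u v x3 y3 by simp
      \<comment> \<open>\<open>N\<close> is the number of leaves of two stars that together span all
        vertices; integers avoid truncated subtraction.\<close>
      define X Y N where "X = int x" and "Y = int y" and "N = int n - 2"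
      have bound: "2 * int (T {..<n}) \<le> X * (X - 1) + Y * (N - X - 1)"
      proof -
        have N: "N = X + Y + int (card R')" using cR' by (simp add: X_def Y_def N_def)
        moreover have "2 * int (T {..<n}) \<le> int x * int (x - 1) + int y * int (y - 1) + int (card R') * int y"
          using TT by (metis of_nat_add of_nat_le_iff of_nat_mult of_nat_numeral)
        ultimately show ?thesis
          using x3 y3 unfolding N by (simp add: X_def Y_def of_nat_diff algebra_simps)
      qed
      have XY: "3 \<le> Y" "Y \<le> X" "X + Y \<le> N" "98 \<le> N" "2 * X \<le> N + 7"
        using y3 yx cR' n xcap by (auto simp: X_def Y_def N_def)
      have val': "N * (N - 2) \<le> 4 * int (two_star_value n)"
        using val by (simp add: N_def algebra_simps)
      \<comment> \<open>\<open>2 * x < n\<close> means \<open>2 * X \<le> N + 1\<close>. The extreme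
        value of it is separated because only the exact odd value of the target suffices there; in
        the third case a vertex is lost.\<close>
      consider "2 * X \<le> N" | "2 * X = N + 1" | "N < 2 * X" "X + Y + 1 \<le> N"
        using uv unfolding X_def Y_def N_def by linarith
      then show ?thesis
      proof cases
        case 1
        have "Y * (N - X - 1) \<le> X * (N - X - 1)"
          using XY by (intro mult_right_mono) auto
        then have "2 * int (T {..<n}) \<le> X * (N - 2)"
          using bound by (simp add: algebra_simps)
        moreover have "(2 * X) * (N - 2) \<le> N * (N - 2)"
          using 1 XY by (intro mult_right_mono) auto
        ultimately show ?thesis using val' by linarith
      next
        case 2
        have "Y * (N - X - 1) \<le> (X - 1) * (N - X - 1)"
          using XY 2 by (intro mult_right_mono) auto
        then have "2 * int (T {..<n}) \<le> X * (X - 1) + (X - 1) * (X - 2)"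
          using bound 2 by (simp add: algebra_simps)
        also have "\<dots> = 2 * ((X - 1) * (X - 1))" by (simp add: algebra_simps)
        also have "(X - 1) * (X - 1) = int (two_star_value n)"
        proof -
          have "n = 2 * x + 1" using 2 by (simp add: X_def N_def)
          then show ?thesis
            using two_star_value_ge(2)[of n x] n x3 by (simp add: X_def of_nat_diff)
        qed
        finally show ?thesis by linarith
      next
        case 3
        have "Y * (N - X - 1) \<le> (N - X - 1) * (N - X - 1)"
          using XY 3 by (intro mult_right_mono) auto
        then have b: "2 * int (T {..<n}) \<le> X * (X - 1) + (N - X - 1) * (N - X - 1)"
          using bound by linarith
        \<comment> \<open>\<open>j\<close> is the imbalance, at most 7 by the degree cap. It gains
          only a constant, whereas the lost vertex costs a term linear in \<open>N\<close>.\<close>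
        define j where "j = 2 * X - N"
        have j: "1 \<le> j" "j \<le> 7" using 3 XY by (auto simp: j_def)
        have "4 * (X * (X - 1) + (N - X - 1) * (N - X - 1)) =
            2 * (N * N) - 6 * N + (j * j - 2 * j + (j + 2) * (j + 2))"
          by (simp add: j_def algebra_simps)
        moreover have "j * j \<le> 7 * 7" using j by (intro mult_mono) auto
        moreover have "(j + 2) * (j + 2) \<le> 9 * 9" using j by (intro mult_mono) auto
        ultimately have "4 * (X * (X - 1) + (N - X - 1) * (N - X - 1)) \<le> 2 * (N * N) - 4 * N"
          using XY j by linarith
        also have "\<dots> \<le> 8 * int (two_star_value n)"
          using val' by (simp add: algebra_simps)
        finally have "4 * (2 * int (T {..<n})) \<le> 8 * int (two_star_value n)"
          using mult_left_mono[OF b, of 4] by (meson order_trans zero_le_numeral)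
        then show ?thesis by simp
      qed
    qed
  qed
  then show ?thesis by (simp add: score_P3[OF C] T_def)
qed

subsection \<open>Blocker's strategy\<close>

lemma nbrs_insert:
  assumes "p \<noteq> q"
  shows "nbrs (insert {p, q} C) p = insert q (nbrs C p)"
    and "nbrs (insert {p, q} C) q = insert p (nbrs C q)"
    and "w \<noteq> p \<Longrightarrow> w \<noteq> q \<Longrightarrow> nbrs (insert {p, q} C) w = nbrs C w"
proof -
  show "nbrs (insert {p, q} C) p = insert q (nbrs C p)"
    and "nbrs (insert {p, q} C) q = insert p (nbrs C q)"
    using assms unfolding nbrs_def insert_iff doubleton_eq_iff by blast+
  show "nbrs (insert {p, q} C) w = nbrs C w" if "w \<noteq> p" "w \<noteq> q"
    using that unfolding nbrs_def insert_iff doubleton_eq_iff by blast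
qed

lemma deg_insert:
  assumes "C \<subseteq> nsets {..<n::nat} 2" "p \<noteq> q" "{p, q} \<notin> C"
  shows "deg (insert {p, q} C) p = deg C p + 1"
    and "deg (insert {p, q} C) q = deg C q + 1"
    and "w \<noteq> p \<Longrightarrow> w \<noteq> q \<Longrightarrow> deg (insert {p, q} C) w = deg C w"
proof -
  have "{q, p} \<notin> C" using assms(3) by (simp add: insert_commute)
  then show "deg (insert {p, q} C) p = deg C p + 1" "deg (insert {p, q} C) q = deg C q + 1"
    unfolding deg_def nbrs_insert(1,2)[OF assms(2)]
    using assms(3) finite_nbrs[OF assms(1), of p] finite_nbrs[OF assms(1), of q] by simp_all
  show "deg (insert {p, q} C) w = deg C w" if "w \<noteq> p" "w \<noteq> q"
    using nbrs_insert(3)[OF assms(2) that] by (simp add: deg_def)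
qed

lemma deg_insert_le:
  assumes "C \<subseteq> nsets {..<n::nat} 2" "p \<noteq> q" "{p, q} \<notin> C"
  shows "deg (insert {p, q} C) w \<le> deg C w + 1"
  using deg_insert[OF assms] by (metis le_add1 order_refl)

lemma deg_mono:
  assumes "C \<subseteq> C'" "C' \<subseteq> nsets {..<n::nat} 2"
  shows "deg C v \<le> deg C' v"
  unfolding deg_def using assms by (intro card_mono finite_nbrs) auto

lemma deg_eq_0_iff:
  assumes "C \<subseteq> nsets {..<n::nat} 2"
  shows "deg C v = 0 \<longleftrightarrow> nbrs C v = {}"
  using finite_nbrs[OF assms] by (simp add: deg_def)

text \<open>\<open>avail n C B u\<close> are the vertices that can still be joined to a star with center \<open>u\<close>.\<close>

definition isol :: "nat \<Rightarrow> nat set set \<Rightarrow> nat set" where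
  "isol n C = {x. x < n \<and> nbrs C x = {}}"

definition avail :: "nat \<Rightarrow> nat set set \<Rightarrow> nat set set \<Rightarrow> nat \<Rightarrow> nat set" where
  "avail n C B u = {x \<in> isol n C. x \<noteq> u \<and> {u, x} \<notin> B}"

text \<open>The potential is \<open>2 * deg C u + card (avail n C B u)\<close>. When nothing is
  available at \<open>u\<close> any more, only the degree bound is kept; its extra 1 allows for a
  last extension to which there is no answer at \<open>u\<close>.\<close>

definition capped_at :: "nat \<Rightarrow> nat \<Rightarrow> nat set set \<Rightarrow> nat set set \<Rightarrow> nat \<Rightarrow> bool" where
  "capped_at k n C B u \<longleftrightarrow>
     (avail n C B u = {} \<or> 2 * deg C u + card (avail n C B u) \<le> n + k) \<and> 2 * deg C u \<le> n + k + 1"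

text \<open>If Blocker answers every extension of the star at \<open>u\<close> at \<open>u\<close> itself, then
  \<open>2 * deg C u + card (avail n C B u)\<close> never increases: this keeps all degrees below \<open>n / 2 + O(1)\<close>.\<close>

definition capped :: "nat \<Rightarrow> nat \<Rightarrow> nat set set \<Rightarrow> nat set set \<Rightarrow> bool" where
  "capped k n C B \<longleftrightarrow> (\<forall>u. capped_at k n C B u)"

section \<open>Available vertices and the degree cap\<close>

lemma finite_isol: "finite (isol n C)"
  by (simp add: isol_def)

lemma finite_avail: "finite (avail n C B u)"
  by (simp add: avail_def finite_isol)

lemma isol_antimono: "C \<subseteq> C' \<Longrightarrow> isol n C' \<subseteq> isol n C"
  unfolding isol_def nbrs_def by blast

lemma avail_antimono: "C \<subseteq> C' \<Longrightarrow> B \<subseteq> B' \<Longrightarrow> avail n C' B' u \<subseteq> avail n C B u"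
  using isol_antimono[of C C' n] by (auto simp: avail_def)

lemma not_isol: "{x, y} \<in> C \<Longrightarrow> x \<notin> isol n C" "{x, y} \<in> C \<Longrightarrow> y \<notin> isol n C"
proof -
  show "{x, y} \<in> C \<Longrightarrow> x \<notin> isol n C"
    unfolding isol_def nbrs_def by blast
  assume "{x, y} \<in> C"
  then have "{y, x} \<in> C" by (simp add: insert_commute)
  then show "y \<notin> isol n C" unfolding isol_def nbrs_def by blast
qed

lemma isol_insert:
  assumes "p \<noteq> q"
  shows "isol n (insert {p, q} C) = isol n C - {p, q}"
proof -
  have "nbrs (insert {p, q} C) x = {} \<longleftrightarrow> nbrs C x = {} \<and> x \<noteq> p \<and> x \<noteq> q" for x
    using nbrs_insert[OF assms, where C = C] by (cases "x = p"; cases "x = q") auto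
  then show ?thesis by (auto simp: isol_def)
qed

lemma capped_at_mono:
  assumes "capped_at k n C B u" "C \<subseteq> C'" "B \<subseteq> B'" "deg C' u \<le> deg C u + j"
  shows "capped_at (k + 2 * j) n C' B' u"
proof -
  have "avail n C' B' u \<subseteq> avail n C B u"
    using avail_antimono assms by blast
  moreover from this have "card (avail n C' B' u) \<le> card (avail n C B u)"
    by (intro card_mono finite_avail)
  ultimately show ?thesis
    using assms(1,4) unfolding capped_at_def by auto
qed

text \<open>One Constructor move not answered at its star raises each degree by at most 1, hence the
  slack by 2. This is the price when Blocker spends his move elsewhere.\<close>

lemma capped_insert:
  assumes "C \<subseteq> nsets {..<n::nat} 2" "p \<noteq> q" "{p, q} \<notin> C" "capped k n C B" "B \<subseteq> B'"
  shows "capped (k + 2) n (insert {p, q} C) B'"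
  unfolding capped_def
proof
  fix u
  show "capped_at (k + 2) n (insert {p, q} C) B' u"
    using capped_at_mono[of k n C B u "insert {p, q} C" B' 1] deg_insert_le[OF assms(1-3)]
      assms(4,5) subset_insertI[of C "{p, q}"] by (simp add: capped_def)
qed

lemma capped_mono:
  assumes "capped k n C B" "B \<subseteq> B'"
  shows "capped k n C B'"
  using assms capped_at_mono[where C = C and C' = C and B = B and B' = B' and j = 0]
  by (simp add: capped_def)

lemma card_avail_le:
  assumes C: "C \<subseteq> nsets {..<n} 2" and u: "u < n"
  shows "card (avail n C B u) + deg C u + 1 \<le> n"
proof -
  have "nbrs C u \<subseteq> {..<n}" "u \<notin> nbrs C u" using nbrs_subset[OF C] by blast+
  moreover have "avail n C B u \<inter> nbrs C u = {}"
    using not_isol(2) unfolding avail_def by fastforce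
  moreover have "avail n C B u \<subseteq> {..<n}" "u \<notin> avail n C B u"
    by (auto simp: avail_def isol_def)
  ultimately have "insert u (avail n C B u \<union> nbrs C u) \<subseteq> {..<n}"
    and "card (insert u (avail n C B u \<union> nbrs C u)) = card (avail n C B u) + deg C u + 1"
    using u finite_avail[of n C B u] finite_nbrs[OF C, of u]
    by (auto simp: card_Un_disjoint deg_def simp del: mem_nbrs)
  then show ?thesis
    using card_mono[OF finite_lessThan] by (metis card_lessThan)
qed

text \<open>By \<open>card_avail_le\<close> the potential is at most \<open>deg C u + n - 1\<close>,
  which is at most \<open>n + 1\<close>; so the cap never has to be defended at vertices of degree
  at most 2.\<close>

lemma capped_at_small:
  assumes C: "C \<subseteq> nsets {..<n} 2" and d: "deg C u \<le> 2" and "2 \<le> n" "1 \<le> k"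
  shows "capped_at k n C B u"
proof (cases "u < n")
  case True
  then show ?thesis
    using card_avail_le[OF C True, of B] assms by (auto simp: capped_at_def)
next
  case False
  have "nbrs C u = {}"
  proof (rule ccontr)
    assume "nbrs C u \<noteq> {}"
    then obtain w where "{u, w} \<in> C" by auto
    then show False using edge_on(1)[OF C] False by blast
  qed
  moreover have "card (avail n C B u) \<le> card {..<n}"
    by (intro card_mono) (auto simp: avail_def isol_def)
  ultimately show ?thesis
    using assms by (simp add: capped_at_def deg_def)
qed

text \<open>Any neighbours \<open>a\<close> of \<open>p\<close> and \<open>b\<close> of
  \<open>q\<close> form a walk through the new edge, so \<open>a = b\<close> by
  \<open>P4_freeD\<close>: joining two touched vertices can only close a triangle.\<close>

lemma triangle_if_both_touched:
  assumes P: "P4_free (insert {p, q} C)" and C: "insert {p, q} C \<subseteq> nsets {..<n::nat} 2"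
    and "p \<noteq> q" "{p, q} \<notin> C" "nbrs C p \<noteq> {}" "nbrs C q \<noteq> {}"
  obtains r where "nbrs C p = {r}" "nbrs C q = {r}"
proof -
  have eq: "a = b" if "a \<in> nbrs C p" "b \<in> nbrs C q" for a b
  proof (rule P4_freeD[OF P C, of a p q b])
    show "a \<noteq> q" "p \<noteq> b" using that assms(4) by (auto simp: insert_commute)
  qed (use that in \<open>simp_all add: insert_commute\<close>)
  obtain r where r: "r \<in> nbrs C p" using assms(5) by blast
  obtain s where s: "s \<in> nbrs C q" using assms(6) by blast
  have "nbrs C q = {r}" using eq[OF r] s by (metis singletonD singletonI subsetI subset_antisym)
  moreover have "nbrs C p = {r}" using eq[OF _ s] r by (metis singletonD singletonI subsetI subset_antisym)
  ultimately show ?thesis using that by blast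
qed

text \<open>Unless a triangle is closed, the move attaches an isolated vertex to some
  \<open>p\<close>. It raises the potential at \<open>p\<close> by at most 1, and claiming
  \<open>{p, x}\<close> for an available \<open>x\<close> takes this back. Other vertices keep their
  degree or have degree at most 2.\<close>

lemma capped_reply:
  assumes C: "insert {p, q} C \<subseteq> nsets {..<n} 2" and P: "P4_free (insert {p, q} C)"
    and e: "p \<noteq> q" "{p, q} \<notin> C" "{p, q} \<notin> B"
    and cap: "capped k n C B" and n: "2 \<le> n" "1 \<le> k"
  shows "capped k n (insert {p, q} C) B \<or>
    (\<exists>f\<in>unclaimed n (insert {p, q} C) B. capped k n (insert {p, q} C) (insert f B))"
proof -
  let ?C = "insert {p, q} C"
  have C0: "C \<subseteq> nsets {..<n} 2" using C by blast
  have pq: "p < n" "q < n" using edge_on[OF C, of p q] by auto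
  note deg = deg_insert[OF C0 e(1,2)]
  have small: "capped_at k n ?C B' w" if "deg ?C w \<le> 2" for w B'
    using capped_at_small[OF C that n] .
  have other: "capped_at k n ?C B' w" if "w \<noteq> p" "w \<noteq> q" "B \<subseteq> B'" for w B'
    using capped_at_mono[of k n C B w ?C B' 0] cap deg(3)[OF that(1,2)] that(3)
    by (auto simp: capped_def)
  \<comment> \<open>Here \<open>p\<close> and \<open>q\<close> are bound anew with \<open>q\<close>
    as the isolated end, since either end of the claimed edge may be the isolated one.\<close>
  have reply: "capped k n ?C B \<or> (\<exists>f\<in>unclaimed n ?C B. capped k n ?C (insert f B))"
    if pq: "nbrs C q = {}" "q < n" "p < n" "q \<noteq> p" "{p, q} \<notin> B"
      and dp: "deg ?C p = deg C p + 1" and dq: "deg ?C q = deg C q + 1"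
      and rest: "\<And>w B'. w \<noteq> p \<Longrightarrow> w \<noteq> q \<Longrightarrow> B \<subseteq> B' \<Longrightarrow> capped_at k n ?C B' w" for p q
  proof -
    have q: "deg ?C q \<le> 2" using pq dq by (simp add: deg_def)
    have qa: "q \<in> avail n C B p" using pq by (simp add: avail_def isol_def)
    then have cp: "2 * deg C p + card (avail n C B p) \<le> n + k" "2 * deg C p \<le> n + k"
      using cap by (auto simp: capped_def capped_at_def)
    have "deg ?C q \<noteq> 0" using dq by simp
    then have "q \<notin> avail n ?C B p"
      using deg_eq_0_iff[OF C, of q] by (auto simp: avail_def isol_def)
    then have "avail n ?C B p \<subset> avail n C B p"
      using qa avail_antimono[of C ?C B B n p] by blast
    then have card: "card (avail n ?C B p) < card (avail n C B p)"
      by (intro psubset_card_mono finite_avail)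
    have d: "2 * deg ?C p \<le> n + k + 1"
      using cp card dp by linarith
    show ?thesis
    proof (cases "avail n ?C B p = {}")
      case True
      then have "capped_at k n ?C B p" using d by (simp add: capped_at_def)
      then have "capped k n ?C B" using rest small[OF q] by (metis capped_def order_refl)
      then show ?thesis by blast
    next
      case False
      then obtain x where x: "x \<in> avail n ?C B p" by blast
      have "avail n ?C (insert {p, x} B) p \<subset> avail n ?C B p"
        using x by (auto simp: avail_def)
      then have "card (avail n ?C (insert {p, x} B) p) < card (avail n ?C B p)"
        by (intro psubset_card_mono finite_avail)
      then have "capped_at k n ?C (insert {p, x} B) p"
        using d cp card dp by (auto simp: capped_at_def)
      then have "capped k n ?C (insert {p, x} B)"
        using rest small[OF q] by (metis capped_def subset_insertI)
      moreover have "{p, x} \<in> unclaimed n ?C B"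
        using x pq not_isol(2)[of p x ?C n] unfolding unclaimed_iff
        by (auto simp: avail_def isol_def nsets_def)
      ultimately show ?thesis by blast
    qed
  qed
  show ?thesis
  proof (cases "nbrs C p = {} \<or> nbrs C q = {}")
    case True
    then show ?thesis
    proof
      assume "nbrs C q = {}"
      then show ?thesis using reply[of q p] pq e deg other by blast
    next
      assume "nbrs C p = {}"
      moreover have "{q, p} \<notin> B" using e by (simp add: insert_commute)
      ultimately show ?thesis using reply[of p q] pq e deg other by blast
    qed
  next
    case False
    then obtain r where "nbrs C p = {r}" "nbrs C q = {r}"
      using triangle_if_both_touched[OF P C e(1,2)] by blast
    then have "deg ?C p \<le> 2" "deg ?C q \<le> 2" using deg by (simp_all add: deg_def)
    then have "capped k n ?C B" using small other by (metis capped_def order_refl)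
    then show ?thesis by blast
  qed
qed

section \<open>Positions from which two spanning stars are impossible\<close>

definition two_stars :: "nat \<Rightarrow> nat set set \<Rightarrow> nat \<Rightarrow> nat \<Rightarrow> bool" where
  "two_stars n C u v \<longleftrightarrow> u \<noteq> v \<and> 3 \<le> deg C u \<and> 3 \<le> deg C v \<and>
     (\<forall>x<n. x = u \<or> x = v \<or> {u, x} \<in> C \<or> {v, x} \<in> C)"

text \<open>Whatever he does, Constructor can no longer absorb all vertices into two stars.\<close>

definition safe :: "nat \<Rightarrow> nat set set \<Rightarrow> nat set set \<Rightarrow> bool" where
  "safe n C B \<longleftrightarrow> (\<forall>C' u v. C \<subseteq> C' \<longrightarrow> C' \<subseteq> nsets {..<n} 2 \<longrightarrow> P4_free C' \<longrightarrow> C' \<inter> B = {} \<longrightarrow>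
     \<not> two_stars n C' u v)"

lemma safe_mono:
  assumes "safe n C B" "B \<subseteq> B'"
  shows "safe n C B'"
  unfolding safe_def
proof (intro allI impI)
  fix D u v
  assume D: "C \<subseteq> D" "D \<subseteq> nsets {..<n} 2" "P4_free D" "D \<inter> B' = {}"
  then have "D \<inter> B = {}" using assms(2) by blast
  then show "\<not> two_stars n D u v" using D assms(1) by (simp add: safe_def)
qed

lemma safe_insert:
  assumes "safe n C B"
  shows "safe n (insert e C) B"
  using assms by (simp add: safe_def)

text \<open>All vertices other than the centers are leaves by \<open>nbrs_leaf\<close>, so the
  centers cover every edge; adjacent centers would be leaves of each other, of degree 1.\<close>

lemma two_stars_edge:
  assumes C: "C \<subseteq> nsets {..<n} 2" and P: "P4_free C" and S: "two_stars n C u v"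
  shows "{u, v} \<notin> C" and "{x, y} \<in> C \<Longrightarrow> x \<in> {u, v} \<or> y \<in> {u, v}"
proof -
  have leaf: "nbrs C z = {u}" if "{u, z} \<in> C" for z
    using nbrs_leaf[OF P C that] S by (simp add: two_stars_def)
  have leaf': "nbrs C z = {v}" if "{v, z} \<in> C" for z
    using nbrs_leaf[OF P C that] S by (simp add: two_stars_def)
  show "{u, v} \<notin> C"
    using leaf[of v] S by (auto simp: two_stars_def deg_def)
  assume e: "{x, y} \<in> C"
  then have y: "y \<in> nbrs C x" and "x < n" using edge_on[OF C e] by auto
  then have "x = u \<or> x = v \<or> {u, x} \<in> C \<or> {v, x} \<in> C"
    using S unfolding two_stars_def by blast
  then show "x \<in> {u, v} \<or> y \<in> {u, v}"
    using leaf[of x] leaf'[of x] y by blast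
qed

text \<open>Any other vertex has its neighbours among the two centers, and being a leaf it cannot
  have both.\<close>

lemma two_stars_center:
  assumes C: "C \<subseteq> nsets {..<n} 2" and P: "P4_free C" and S: "two_stars n C u v"
    and w: "2 \<le> deg C w"
  shows "w \<in> {u, v}"
proof (rule ccontr)
  assume nw: "w \<notin> {u, v}"
  have "nbrs C w \<subseteq> {u, v}"
    using two_stars_edge(2)[OF C P S, of w] nw unfolding nbrs_def by blast
  moreover have "card {u, v} = 2" using S by (simp add: two_stars_def)
  ultimately have "nbrs C w = {u, v}"
    using w by (intro card_seteq) (auto simp: deg_def)
  moreover from this have "{u, w} \<in> C" by (auto simp: nbrs_def insert_commute)
  then have "nbrs C w = {u}" using nbrs_leaf[OF P C] S by (simp add: two_stars_def)
  ultimately show False using S by (auto simp: two_stars_def)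
qed

text \<open>Two centers would have to cover all edges, but they cannot cover three pairwise disjoint
  ones.\<close>

lemma safe_three_edges:
  assumes "{a, b} \<in> C" "{c, d} \<in> C" "{x, y} \<in> C"
    and "{a, b} \<inter> {c, d} = {}" "{a, b} \<inter> {x, y} = {}" "{c, d} \<inter> {x, y} = {}"
  shows "safe n C B"
  unfolding safe_def
proof (intro allI impI notI)
  fix C' u v assume C: "C \<subseteq> C'" "C' \<subseteq> nsets {..<n} 2" "P4_free C'" and S: "two_stars n C' u v"
  have "a \<in> {u, v} \<or> b \<in> {u, v}" "c \<in> {u, v} \<or> d \<in> {u, v}" "x \<in> {u, v} \<or> y \<in> {u, v}"
    using two_stars_edge(2)[OF C(2,3) S] assms(1-3) C(1) by blast+
  then show False using assms(4-6) by auto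
qed

text \<open>Covering a triangle takes two of its vertices, and these are adjacent, unlike the
  centers.\<close>

lemma safe_triangle:
  assumes "{p, q} \<in> C" "{q, r} \<in> C" "{p, r} \<in> C" "C \<subseteq> nsets {..<n} 2"
  shows "safe n C B"
  unfolding safe_def
proof (intro allI impI notI)
  fix C' u v assume C: "C \<subseteq> C'" "C' \<subseteq> nsets {..<n} 2" "P4_free C'" and S: "two_stars n C' u v"
  have ne: "p \<noteq> q" "q \<noteq> r" "p \<noteq> r" using edge_on(3)[OF assms(4)] assms(1-3) by blast+
  have "p \<in> {u, v} \<or> q \<in> {u, v}" "q \<in> {u, v} \<or> r \<in> {u, v}" "p \<in> {u, v} \<or> r \<in> {u, v}"
    using two_stars_edge(2)[OF C(2,3) S] assms(1-3) C(1) by blast+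
  then have "{u, v} = {p, q} \<or> {u, v} = {q, r} \<or> {u, v} = {p, r}"
    using ne by auto
  then show False using two_stars_edge(1)[OF C(2,3) S] assms(1-3) C(1) by (metis subsetD)
qed

text \<open>Vertices of degree 2 are bound to be the final centers, by
  \<open>two_stars_center\<close>, and \<open>x\<close> is cut off from both of them.\<close>

lemma safe_dead:
  assumes "2 \<le> deg C u" "2 \<le> deg C v" "u \<noteq> v" "x < n" "x \<noteq> u" "x \<noteq> v" "{u, x} \<in> B" "{v, x} \<in> B"
  shows "safe n C B"
  unfolding safe_def
proof (intro allI impI notI)
  fix C' u' v' assume C: "C \<subseteq> C'" "C' \<subseteq> nsets {..<n} 2" "P4_free C'"
    and disj: "C' \<inter> B = {}" and S: "two_stars n C' u' v'"
  have "u \<in> {u', v'}" "v \<in> {u', v'}"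
    using two_stars_center[OF C(2,3) S] deg_mono[OF C(1,2)] assms(1,2) order_trans by blast+
  then have "{u, x} \<in> C' \<or> {v, x} \<in> C'"
    using S assms(3-6) unfolding two_stars_def by auto
  then show False using disj assms(7,8) by blast
qed

lemma kill_reply:
  assumes C: "C \<subseteq> nsets {..<n} 2" and d: "2 \<le> deg C u" "2 \<le> deg C v" "u \<noteq> v"
    and x: "x \<in> isol n C" "{u, x} \<in> B"
  shows "safe n C B \<or> (\<exists>f\<in>unclaimed n C B. safe n C (insert f B))"
proof -
  have ne: "x < n" "x \<noteq> u" "x \<noteq> v" using x d by (auto simp: isol_def deg_def)
  show ?thesis
  proof (cases "{v, x} \<in> B")
    case True
    then show ?thesis using safe_dead[OF d ne x(2)] by blast
  next
    case False
    obtain w where "{v, w} \<in> C" using ex_nbr_avoiding[of "{}" C v] d by auto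
    then have "v < n" using edge_on[OF C] by blast
    then have "{v, x} \<in> unclaimed n C B"
      using ne False not_isol(2)[of v x C n] x(1) by (auto simp: unclaimed_iff nsets_def)
    moreover have "safe n C (insert {v, x} B)"
      using x(2) by (intro safe_dead[OF d ne]) auto
    ultimately show ?thesis by blast
  qed
qed

text \<open>The intermediate stage of \<open>two_stars\<close>: the centers are settled from degree
  2 on, while isolated vertices are still waiting to be absorbed.\<close>

definition double_star :: "nat \<Rightarrow> nat set set \<Rightarrow> nat \<Rightarrow> nat \<Rightarrow> bool" where
  "double_star n C u v \<longleftrightarrow> u \<noteq> v \<and> 2 \<le> deg C u \<and> 2 \<le> deg C v \<and> {u, v} \<notin> C \<and>
     (\<forall>w<n. w \<in> isol n C \<or> w = u \<or> w = v \<or> {u, w} \<in> C \<or> {v, w} \<in> C) \<and>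
     (\<forall>w. w \<noteq> u \<longrightarrow> w \<noteq> v \<longrightarrow> deg C w \<le> 1)"

lemma deg_ge_2I:
  assumes "C \<subseteq> nsets {..<n::nat} 2" "{w, a} \<in> C" "{w, b} \<in> C" "a \<noteq> b"
  shows "2 \<le> deg C w"
proof -
  have "{a, b} \<subseteq> nbrs C w" using assms by simp
  then have "card {a, b} \<le> deg C w"
    unfolding deg_def by (intro card_mono finite_nbrs[OF assms(1)])
  then show ?thesis using assms(4) by simp
qed

lemma double_star_disjoint:
  assumes C: "C \<subseteq> nsets {..<n} 2" and D: "double_star n C u v"
    and y: "{u, y} \<in> C" "{v, y} \<in> C"
  shows False
proof -
  have D': "u \<noteq> v" "{u, v} \<notin> C" "\<And>w. w \<noteq> u \<Longrightarrow> w \<noteq> v \<Longrightarrow> deg C w \<le> 1"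
    using D by (simp_all add: double_star_def)
  have "y \<noteq> u" "y \<noteq> v" using edge_on(3)[OF C] y by blast+
  moreover have "{y, u} \<in> C" "{y, v} \<in> C" using y by (simp_all add: insert_commute)
  then have "2 \<le> deg C y" using deg_ge_2I[OF C _ _ D'(1)] by blast
  ultimately show False using D'(3)[of y] by simp
qed

lemma double_star_card:
  assumes C: "C \<subseteq> nsets {..<n} 2" and D: "double_star n C u v"
  shows "deg C u + deg C v + card (isol n C) + 2 = n"
proof -
  have D': "u \<noteq> v" "{u, v} \<notin> C" "2 \<le> deg C u" "2 \<le> deg C v"
    "\<And>w. w < n \<Longrightarrow> w \<in> isol n C \<or> w = u \<or> w = v \<or> {u, w} \<in> C \<or> {v, w} \<in> C"
    using D by (simp_all add: double_star_def)
  have sub: "nbrs C u \<subseteq> {..<n} - {u}" "nbrs C v \<subseteq> {..<n} - {v}"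
    using nbrs_subset[OF C] by blast+
  obtain a where a: "{u, a} \<in> C" using ex_nbr_avoiding[of "{}" C u] D' by auto
  obtain b where b: "{v, b} \<in> C" using ex_nbr_avoiding[of "{}" C v] D' by auto
  have uv: "u < n" "v < n" using edge_on(1)[OF C] a b by blast+
  have vu: "{v, u} \<notin> C" using D'(2) by (simp add: insert_commute)
  have "{..<n} = insert u (insert v (nbrs C u \<union> nbrs C v \<union> isol n C))"
    using sub uv D'(5) unfolding isol_def nbrs_def by blast
  moreover have "u \<notin> insert v (nbrs C u \<union> nbrs C v \<union> isol n C)"
    using D'(1) vu sub not_isol(1)[OF a] unfolding nbrs_def by blast
  moreover have "v \<notin> nbrs C u \<union> nbrs C v \<union> isol n C"
    using D'(2) sub not_isol(1)[OF b] unfolding nbrs_def by blast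
  moreover have "nbrs C u \<inter> nbrs C v = {}"
    using double_star_disjoint[OF C D] unfolding nbrs_def by blast
  moreover have "(nbrs C u \<union> nbrs C v) \<inter> isol n C = {}"
    using not_isol(2) unfolding nbrs_def by blast
  moreover note fin = finite_nbrs[OF C, of u] finite_nbrs[OF C, of v] finite_isol[of n C]
  ultimately have "card {..<n} = deg C u + deg C v + card (isol n C) + 2"
    by (simp add: card_Un_disjoint deg_def del: mem_nbrs card_lessThan)
  then show ?thesis by simp
qed

text \<open>Pick edges \<open>{u, a}\<close> and \<open>{v, b}\<close>. A touched vertex outside
  both stars has an edge disjoint from these two, and \<open>safe_three_edges\<close> applies.
  Adjacent centers would give the path \<open>a\<close>, \<open>u\<close>, \<open>v\<close>,
  \<open>b\<close>.\<close>

lemma double_star_or_safe: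
  assumes C: "C \<subseteq> nsets {..<n} 2" and P: "P4_free C"
    and d: "u \<noteq> v" "2 \<le> deg C u" "2 \<le> deg C v"
    and rest: "\<And>w. w \<noteq> u \<Longrightarrow> w \<noteq> v \<Longrightarrow> deg C w \<le> 1"
  shows "double_star n C u v \<or> (\<forall>B. safe n C B)"
proof (rule disjCI)
  assume ns: "\<not> (\<forall>B. safe n C B)"
  have one: "a = b" if "{w, a} \<in> C" "{w, b} \<in> C" "w \<noteq> u" "w \<noteq> v" for w a b
    using deg_ge_2I[OF C that(1,2)] rest[OF that(3,4)] by (cases "a = b") auto
  have ne: "a \<noteq> b" if "{a, b} \<in> C" for a b using edge_on(3)[OF C that] .
  have sym: "{b, a} \<in> C" if "{a, b} \<in> C" for a b using that by (simp add: insert_commute)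
  obtain a where a: "{u, a} \<in> C" "a \<noteq> v"
    using ex_nbr_avoiding[of "{v}" C u] d by auto
  obtain b where b: "{v, b} \<in> C" "b \<noteq> u"
    using ex_nbr_avoiding[of "{u}" C v] d by auto
  have ab: "a \<noteq> b" using one[of a u v] a b sym ne d(1) by metis
  have uv: "{u, v} \<notin> C"
    using P4_freeD[OF P C, of a u v b] a b ab sym by metis
  have "w \<in> isol n C \<or> w = u \<or> w = v \<or> {u, w} \<in> C \<or> {v, w} \<in> C" if wn: "w < n" for w
  proof (rule ccontr)
    assume "\<not> ?thesis"
    then have w: "w \<notin> isol n C" "w \<noteq> u" "w \<noteq> v" "{u, w} \<notin> C" "{v, w} \<notin> C" by blast+
    then obtain z where z: "{w, z} \<in> C" using wn by (auto simp: isol_def)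
    have "z \<noteq> u" "z \<noteq> v" using z w sym by blast+
    moreover from this have "z \<noteq> a" "z \<noteq> b" using one[of z w u] one[of z w v] z a b w sym by blast+
    moreover have "w \<noteq> a" "w \<noteq> b" using w a b by blast+
    ultimately have "safe n C B" for B
      using a b ab w d(1) uv by (intro safe_three_edges[OF a(1) b(1) z]) auto
    then show False using ns by blast
  qed
  then show "double_star n C u v"
    using d rest uv by (simp add: double_star_def)
qed

text \<open>Degree 2 already counts as a center, so closing a triangle also ends the
  opening.\<close>

definition at_most_one_star :: "nat set set \<Rightarrow> bool" where
  "at_most_one_star C \<longleftrightarrow> (\<forall>u v. 2 \<le> deg C u \<longrightarrow> 2 \<le> deg C v \<longrightarrow> u = v)"

text \<open>Here Constructor is forced to claim \<open>{v, x}\<close>: otherwise Blocker does so, and \<open>x\<close>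
  is lost for both stars.\<close>

definition forcing :: "nat \<Rightarrow> nat set set \<Rightarrow> nat set set \<Rightarrow> bool" where
  "forcing n C B \<longleftrightarrow> (\<exists>u v x. double_star n C u v \<and> x \<in> isol n C \<and> {u, x} \<in> B \<and>
     deg C v \<le> deg C u \<and> deg C u \<le> deg C v + 3 \<and> 2 * deg C u < n)"

text \<open>In order: the opening, the forced play between two established stars, the positions in which
  some vertex is lost for Constructor, and the completed pair of stars.\<close>

definition blocker_pos :: "nat \<Rightarrow> nat set set \<Rightarrow> nat set set \<Rightarrow> bool" where
  "blocker_pos n C B \<longleftrightarrow>
     at_most_one_star C \<and> capped 1 n C B \<or>
     forcing n C B \<or>
     safe n C B \<and> capped 3 n C B \<or>
     isol n C = {} \<and> (\<forall>u. 2 * deg C u < n)"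

section \<open>Transitions between Blocker's positions\<close>

lemma blocker_pos_mono:
  assumes "blocker_pos n C B" "B \<subseteq> B'"
  shows "blocker_pos n C B'"
  using assms safe_mono[OF _ assms(2), of n C] capped_mono[OF _ assms(2), of _ n C]
  unfolding blocker_pos_def forcing_def by blast

lemma double_star_sym: "double_star n C u v \<Longrightarrow> double_star n C v u"
  by (simp add: double_star_def insert_commute) blast

text \<open>Blocker cuts some isolated vertex off from the larger center, which creates the threat
  of \<open>forcing\<close>. If no isolated vertex is left, the pair of stars is complete and
  balanced enough.\<close>

lemma double_star_reply:
  assumes C: "C \<subseteq> nsets {..<n} 2" and D: "double_star n C u v"
    and d: "deg C u \<le> deg C v + 3" "deg C v \<le> deg C u + 3" "2 * deg C u < n" "2 * deg C v < n"
  shows "blocker_pos n C B \<or> (\<exists>f\<in>unclaimed n C B. blocker_pos n C (insert f B))"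
proof (cases "isol n C = {}")
  case True
  have "2 * deg C w < n" for w
  proof (cases "w = u \<or> w = v")
    case False
    then have "deg C w \<le> 1" using D by (simp add: double_star_def)
    moreover have "2 \<le> deg C u" using D by (simp add: double_star_def)
    ultimately show ?thesis using d by linarith
  qed (use d in auto)
  then show ?thesis using True by (simp add: blocker_pos_def)
next
  case False
  then obtain x where x: "x \<in> isol n C" by blast
  have reply: ?thesis if D: "double_star n C u v" "deg C v \<le> deg C u" "deg C u \<le> deg C v + 3"
    "2 * deg C u < n" for u v
  proof (cases "{u, x} \<in> B")
    case True
    then have "forcing n C B" using that x unfolding forcing_def by blast
    then show ?thesis by (simp add: blocker_pos_def)
  next
    case False
    have "2 \<le> deg C u" using D(1) by (simp add: double_star_def)
    then obtain a where a: "{u, a} \<in> C" using ex_nbr_avoiding[of "{}" C u] by auto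
    have "u < n" "x \<noteq> u" using edge_on[OF C a] not_isol(1)[OF a] x by blast+
    moreover have "x < n" using x by (simp add: isol_def)
    moreover have "{u, x} \<notin> C" using x not_isol(2) by blast
    ultimately have "{u, x} \<in> unclaimed n C B"
      using False by (auto simp: unclaimed_iff nsets_def)
    moreover have "forcing n C (insert {u, x} B)" using that x unfolding forcing_def by blast
    ultimately show ?thesis unfolding blocker_pos_def by blast
  qed
  show ?thesis
  proof (cases "deg C v \<le> deg C u")
    case True
    then show ?thesis using reply D d by blast
  next
    case False
    then show ?thesis using reply[OF double_star_sym[OF D]] d by simp
  qed
qed

text \<open>Only isolated vertices are available, so by \<open>double_star_card\<close> the
  potential at \<open>u\<close> is at most \<open>n - 2 + deg C u - deg C v\<close>. The allowed
  difference 3 is exactly what slack 1 permits.\<close>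

lemma forcing_capped:
  assumes C: "C \<subseteq> nsets {..<n} 2" and D: "double_star n C u v"
    and d: "deg C v \<le> deg C u" "deg C u \<le> deg C v + 3" "2 * deg C u < n"
  shows "capped 1 n C B"
  unfolding capped_def
proof
  fix w
  have "avail n C B w \<subseteq> isol n C" by (auto simp: avail_def)
  then have a: "card (avail n C B w) \<le> card (isol n C)"
    by (intro card_mono finite_isol)
  note card = double_star_card[OF C D]
  show "capped_at 1 n C B w"
  proof (cases "w = u \<or> w = v")
    case True
    then show ?thesis using a card d by (auto simp: capped_at_def)
  next
    case False
    then have "deg C w \<le> 1" using D by (simp add: double_star_def)
    then show ?thesis using capped_at_small[OF C, of w 1 B] card by linarith
  qed
qed

text \<open>Three kinds of Constructor moves: he complies with \<open>{v, x}\<close> and the smaller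
  star grows; he leaves \<open>x\<close> alone and Blocker makes it lost; or he joins
  \<open>x\<close> to a vertex \<open>w\<close> outside both stars and creates a third disjoint
  edge.\<close>

lemma blocker_pos_step_forcing:
  assumes C: "insert {p, q} C \<subseteq> nsets {..<n} 2" and P: "P4_free (insert {p, q} C)"
    and e: "p \<noteq> q" "{p, q} \<notin> C" "{p, q} \<notin> B" and F: "forcing n C B"
  shows "blocker_pos n (insert {p, q} C) B \<or>
    (\<exists>f\<in>unclaimed n (insert {p, q} C) B. blocker_pos n (insert {p, q} C) (insert f B))"
proof -
  let ?C = "insert {p, q} C"
  have C0: "C \<subseteq> nsets {..<n} 2" using C by blast
  obtain u v x where D: "double_star n C u v" and x: "x \<in> isol n C" "{u, x} \<in> B"
    and d: "deg C v \<le> deg C u" "deg C u \<le> deg C v + 3" "2 * deg C u < n"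
    using F unfolding forcing_def by blast
  have D': "u \<noteq> v" "2 \<le> deg C u" "2 \<le> deg C v" "{u, v} \<notin> C"
    "\<And>w. w < n \<Longrightarrow> w \<in> isol n C \<or> w = u \<or> w = v \<or> {u, w} \<in> C \<or> {v, w} \<in> C"
    "\<And>w. w \<noteq> u \<Longrightarrow> w \<noteq> v \<Longrightarrow> deg C w \<le> 1"
    using D by (simp_all add: double_star_def)
  have xne: "x \<noteq> u" "x \<noteq> v" "deg C x = 0" "x < n"
    using x D' by (auto simp: isol_def deg_def)
  have cap: "capped 3 n ?C B'" if "B \<subseteq> B'" for B'
    using capped_insert[OF C0 e(1,2) forcing_capped[OF C0 D d] that] by (simp add: numeral_3_eq_3)
  have safe_pos: "blocker_pos n ?C B'" if "safe n ?C B'" "B \<subseteq> B'" for B'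
    using that cap by (simp add: blocker_pos_def)
  have big: "2 \<le> deg ?C u" "2 \<le> deg ?C v"
    using deg_mono[OF _ C, of C] D' by (meson order_trans subset_insertI)+
  \<comment> \<open>\<open>w\<close> is not \<open>u\<close> because Blocker owns
    \<open>{u, x}\<close>. If \<open>w\<close> were a leaf of a center \<open>c\<close>, then
    \<open>x\<close>, \<open>w\<close>, \<open>c\<close> and another leaf of \<open>c\<close> would
    form a path; hence \<open>w\<close> was isolated.\<close>
  have case_touch: "safe n ?C B" if "{p, q} = {x, w}" "w \<noteq> v" for w
  proof -
    have xw: "{x, w} \<in> ?C" "x \<noteq> w" "w < n" using that(1) e edge_on[OF C, of x w] by auto
    have "w \<noteq> u" using that e(3) x(2) by (auto simp: insert_commute)
    obtain a where a: "{u, a} \<in> C" "a \<noteq> w" using ex_nbr_avoiding[of "{w}" C u] D' by auto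
    obtain b where b: "{v, b} \<in> C" "b \<noteq> w" using ex_nbr_avoiding[of "{w}" C v] D' by auto
    have xab: "x \<noteq> a" "x \<noteq> b" using x(1) not_isol(2) a b by blast+
    have nadj: "{c, w} \<notin> C" if "{c, y} \<in> C" "y \<noteq> w" "c \<noteq> x" "x \<noteq> y" for c y
    proof
      assume "{c, w} \<in> C"
      then have "{w, c} \<in> ?C" by (simp add: insert_commute)
      then have "x = y" using P4_freeD[OF P C xw(1), of c y] that by simp
      then show False using that by simp
    qed
    have "a \<noteq> b" using double_star_disjoint[OF C0 D] a b by blast
    moreover have "a \<noteq> v" "b \<noteq> u" using a b D'(4) by (auto simp: insert_commute)
    moreover have "w \<in> isol n C"
      using D'(5)[OF xw(3)] nadj[OF a] nadj[OF b] that(2) \<open>w \<noteq> u\<close> xab xne by blast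
    ultimately show ?thesis
      using a b xab xne \<open>w \<noteq> u\<close> that(2) D'(1) xw
      by (intro safe_three_edges[of u a ?C v b x w]) auto
  qed
  consider "{p, q} = {v, x}" | "x \<notin> {p, q}" | w where "{p, q} = {x, w}" "w \<noteq> v"
    by (metis doubleton_eq_iff insert_iff singletonD)
  then show ?thesis
  proof cases
    case 1
    have vx: "?C = insert {v, x} C" "{v, x} \<notin> C" "v \<noteq> x"
      using 1 e xne by auto
    note deg = deg_insert[OF C0 vx(3,2), folded vx(1)]
    have iso: "isol n ?C = isol n C - {v, x}"
      using isol_insert[OF vx(3)] vx(1) by simp
    have du: "deg ?C u = deg C u" using deg(3)[of u] D'(1) xne by simp
    have "double_star n ?C u v"
      unfolding double_star_def
    proof (intro conjI allI impI)
      show "{u, v} \<notin> ?C" using D'(4) D'(1) xne 1 by (auto simp: doubleton_eq_iff)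
    next
      fix w assume "w < n"
      then show "w \<in> isol n ?C \<or> w = u \<or> w = v \<or> {u, w} \<in> ?C \<or> {v, w} \<in> ?C"
        using D'(5)[of w] vx(1) iso by (cases "w = x") auto
    next
      fix w assume "w \<noteq> u" "w \<noteq> v"
      then show "deg ?C w \<le> 1"
        using deg(2) deg(3)[of w] D'(6)[of w] xne(3) by (cases "w = x") auto
    qed (use D'(1) big in auto)
    \<comment> \<open>Before the move \<open>x\<close> was isolated and \<open>v\<close> had the
      smaller degree, so \<open>2 * deg C v + 3 \<le> n\<close>.\<close>
    moreover have "2 * deg ?C v < n"
    proof -
      have "card (isol n C) \<noteq> 0" using x(1) finite_isol by auto
      then show ?thesis using double_star_card[OF C0 D] deg(1) d by linarith
    qed
    ultimately show ?thesis
      using double_star_reply[OF C] du deg(1) d by simp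
  next
    case 2
    have "x \<in> isol n ?C" using isol_insert[OF e(1)] x(1) 2 by simp
    then have "safe n ?C B \<or> (\<exists>f\<in>unclaimed n ?C B. safe n ?C (insert f B))"
      using kill_reply[OF C big D'(1) _ x(2)] by blast
    then show ?thesis using safe_pos by blast
  next
    case 3
    then show ?thesis using case_touch safe_pos by blast
  qed
qed

text \<open>The critical move creates a second center \<open>p\<close>, of degree exactly 2, next to
  the old center \<open>u\<close>. If Blocker already owns an edge from a center to an isolated
  vertex, he can make that vertex lost. Otherwise \<open>u\<close> must still be small, and the
  forced play begins.\<close>

lemma blocker_pos_step_one_star:
  assumes C: "insert {p, q} C \<subseteq> nsets {..<n} 2" and P: "P4_free (insert {p, q} C)" and n: "100 \<le> n"
    and e: "p \<noteq> q" "{p, q} \<notin> C" "{p, q} \<notin> B" and S: "at_most_one_star C" "capped 1 n C B"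
  shows "blocker_pos n (insert {p, q} C) B \<or>
    (\<exists>f\<in>unclaimed n (insert {p, q} C) B. blocker_pos n (insert {p, q} C) (insert f B))"
proof -
  let ?C = "insert {p, q} C"
  have C0: "C \<subseteq> nsets {..<n} 2" using C by blast
  have cap: "capped 3 n ?C B'" if "B \<subseteq> B'" for B'
    using capped_insert[OF C0 e(1,2) S(2) that] by (simp add: numeral_3_eq_3)
  have safe_pos: "blocker_pos n ?C B'" if "safe n ?C B'" "B \<subseteq> B'" for B'
    using that cap by (simp add: blocker_pos_def)
  note deg = deg_insert[OF C0 e(1,2)]
  have new: ?thesis
    if q: "nbrs C q = {}" and p: "2 \<le> deg ?C p" and u: "u \<noteq> p" "2 \<le> deg ?C u"
      and dp: "deg ?C p = deg C p + 1" and dq: "deg ?C q = deg C q + 1"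
      and rest: "\<And>w. w \<noteq> p \<Longrightarrow> w \<noteq> q \<Longrightarrow> deg ?C w = deg C w" for p q u
  proof -
    have dq1: "deg ?C q = 1" using q dq by (simp add: deg_def)
    have uq: "u \<noteq> q" using u dq1 by auto
    have du: "deg ?C u = deg C u" using rest u uq by blast
    have one: "w = u" if "2 \<le> deg C w" for w
      using S(1) that u(2) du by (simp add: at_most_one_star_def)
    have dp2: "deg ?C p = 2" using one[of p] u(1) p dp by force
    have small: "deg ?C w \<le> 1" if "w \<noteq> u" "w \<noteq> p" for w
      using one[of w] that rest[of w] dq1 by (cases "w = q") force+
    have "double_star n ?C u p \<or> (\<forall>B. safe n ?C B)"
      using double_star_or_safe[OF C P u(1,2) p small] .
    then show ?thesis
    proof
      assume "\<forall>B. safe n ?C B"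
      then show ?thesis using safe_pos by blast
    next
      assume D: "double_star n ?C u p"
      show ?thesis
      proof (cases "\<exists>x\<in>isol n ?C. {u, x} \<in> B \<or> {p, x} \<in> B")
        case True
        then have "safe n ?C B \<or> (\<exists>f\<in>unclaimed n ?C B. safe n ?C (insert f B))"
          using kill_reply[OF C u(2) p u(1)] kill_reply[OF C p u(2) u(1)[symmetric]] by blast
        then show ?thesis using safe_pos by blast
      next
        case False
        have "u \<notin> isol n ?C" using u(2) by (auto simp: isol_def deg_def)
        then have "isol n ?C \<subseteq> avail n C B u"
          using False isol_antimono[of C ?C n] by (auto simp: avail_def)
        then have card: "card (isol n ?C) \<le> card (avail n C B u)"
          by (intro card_mono finite_avail)
        have "avail n C B u = {} \<or> 2 * deg C u + card (avail n C B u) \<le> n + 1"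
          and "2 * deg C u \<le> n + 2"
          using S(2) by (auto simp: capped_def capped_at_def)
        \<comment> \<open>All \<open>n - 4 - deg C u\<close> isolated vertices were still available
          to \<open>u\<close>, so the cap \<open>n + 1\<close> on the potential leaves degree at
          most 5. Against the degree 2 of \<open>p\<close> this is the difference 3 allowed in
          \<open>forcing\<close>.\<close>
        then have "deg C u \<le> 5"
          using card double_star_card[OF C D] dp2 du n by auto
        then show ?thesis
          using double_star_reply[OF C D] du dp2 u(2) n by simp
      qed
    qed
  qed
  show ?thesis
  proof (cases "at_most_one_star ?C")
    case True
    then show ?thesis
      using capped_reply[OF C P e S(2)] n unfolding blocker_pos_def by fastforce
  next
    case False
    then obtain u v where uv: "u \<noteq> v" "2 \<le> deg ?C u" "2 \<le> deg ?C v"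
      by (auto simp: at_most_one_star_def)
    have "\<not> (deg ?C u = deg C u \<and> deg ?C v = deg C v)"
      using S(1) uv unfolding at_most_one_star_def by metis
    then have pq: "u \<in> {p, q} \<or> v \<in> {p, q}"
      using deg(3) by (metis insertCI)
    consider "nbrs C p \<noteq> {}" "nbrs C q \<noteq> {}" | "nbrs C q = {}" | "nbrs C p = {}" by blast
    then show ?thesis
    proof cases
      case 1
      then obtain r where r: "nbrs C p = {r}" "nbrs C q = {r}"
        using triangle_if_both_touched[OF P C e(1,2)] by blast
      have "{p, r} \<in> C" "{q, r} \<in> C"
        using r unfolding nbrs_def by blast+
      then have "safe n ?C B"
        using safe_triangle[of p q ?C r n B] C by blast
      then show ?thesis using safe_pos by blast
    next
      case 2
      then have "deg ?C q = 1" using deg by (simp add: deg_def)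
      then have "u \<noteq> q" "v \<noteq> q" using uv by auto
      then obtain c where "c \<noteq> p" "2 \<le> deg ?C c" "2 \<le> deg ?C p" using pq uv by (metis insertE singletonD)
      then show ?thesis using new[of q p c] 2 deg by simp
    next
      case 3
      then have "deg ?C p = 1" using deg by (simp add: deg_def)
      then have "u \<noteq> p" "v \<noteq> p" using uv by auto
      then obtain c where "c \<noteq> q" "2 \<le> deg ?C c" "2 \<le> deg ?C q" using pq uv by (metis insertE singletonD)
      then show ?thesis using new[of p q c] 3 deg by simp
    qed
  qed
qed

lemma blocker_pos_step:
  assumes C: "insert e C \<subseteq> nsets {..<n} 2" and P: "P4_free (insert e C)" and n: "100 \<le> n"
    and e: "e \<notin> C" "e \<notin> B" and I: "blocker_pos n C B"
  shows "blocker_pos n (insert e C) B \<or>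
    (\<exists>f\<in>unclaimed n (insert e C) B. blocker_pos n (insert e C) (insert f B))"
proof -
  have C0: "C \<subseteq> nsets {..<n} 2" using C by blast
  have "e \<in> nsets {..<n} 2" using C by blast
  then obtain p q where pq: "e = {p, q}" "p \<noteq> q" "p < n" "q < n"
    using nsets_2E by (metis lessThan_iff)
  consider "at_most_one_star C" "capped 1 n C B" | "forcing n C B" |
    "safe n C B" "capped 3 n C B" | "isol n C = {}" "\<forall>u. 2 * deg C u < n"
    using I by (auto simp: blocker_pos_def)
  then show ?thesis
  proof cases
    case 1
    then show ?thesis
      using blocker_pos_step_one_star[of p q] C P n e pq by simp
  next
    case 2
    then show ?thesis
      using blocker_pos_step_forcing[of p q] C P e pq by simp
  next
    case 3
    have "capped 3 n (insert e C) B \<or>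
        (\<exists>f\<in>unclaimed n (insert e C) B. capped 3 n (insert e C) (insert f B))"
      using capped_reply[of p q C n B 3] C P e pq n 3 by simp
    moreover have "safe n (insert e C) (insert f B)" "safe n (insert e C) B" for f
      using safe_insert[OF 3(1)] safe_mono by blast+
    ultimately show ?thesis unfolding blocker_pos_def by blast
  next
    case 4
    \<comment> \<open>With no isolated vertex left, any further edge closes a triangle and its ends
      get degree 2 only.\<close>
    have "nbrs C p \<noteq> {}" "nbrs C q \<noteq> {}"
      using 4(1) pq by (auto simp: isol_def)
    then obtain r where r: "nbrs C p = {r}" "nbrs C q = {r}"
      using triangle_if_both_touched[of p q C n] P C pq e by metis
    note deg = deg_insert[OF C0 pq(2) e(1)[unfolded pq(1)], folded pq(1)]
    have "2 * deg (insert e C) w < n" for w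
    proof (cases "w = p \<or> w = q")
      case True
      then have "deg (insert e C) w = 2" using deg r by (auto simp: deg_def)
      then show ?thesis using n by simp
    next
      case False
      then show ?thesis using deg(3)[of w] 4(2) by simp
    qed
    moreover have "isol n (insert e C) = {}"
      using 4(1) isol_antimono[of C "insert e C" n] by blast
    ultimately show ?thesis unfolding blocker_pos_def by blast
  qed
qed

text \<open>Each kind of position supplies the hypotheses of \<open>score_le_two_star_value\<close>:
  in the opening there is no second star, safe positions lose a vertex, and in the other two all
  degrees are below \<open>n / 2\<close>.\<close>

lemma blocker_pos_score:
  assumes C: "C \<subseteq> nsets {..<n} 2" and P: "P4_free C" and disj: "C \<inter> B = {}" and n: "100 \<le> n"
    and I: "blocker_pos n C B"
  shows "score n (path_graph 3) C \<le> two_star_value n"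
proof -
  have small: ?thesis if "\<And>u. 2 * deg C u < n"
    using that by (intro score_le_two_star_value[OF P C n]) (auto simp: less_imp_le trans_le_add1)
  consider "at_most_one_star C" "capped 1 n C B" | "forcing n C B" |
    "safe n C B" "capped 3 n C B" | "\<forall>u. 2 * deg C u < n"
    using I by (auto simp: blocker_pos_def)
  then show ?thesis
  proof cases
    case 1
    show ?thesis
    proof (rule score_le_two_star_value[OF P C n])
      fix u v
      have "2 * deg C u \<le> n + 2" using 1(2) by (simp add: capped_def capped_at_def)
      then show "2 * deg C u \<le> n + 5" by simp
      assume "u \<noteq> v" "3 \<le> deg C u" "3 \<le> deg C v"
      then show "2 * deg C u < n \<or> deg C u + deg C v + 3 \<le> n"
        using 1(1) by (simp add: at_most_one_star_def)
    qed
  next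
    case 2
    then obtain u v where D: "double_star n C u v" and d: "deg C v \<le> deg C u" "2 * deg C u < n"
      unfolding forcing_def by blast
    have "2 * deg C w < n" for w
    proof (cases "w = u \<or> w = v")
      case False
      then have "deg C w \<le> 1" using D by (simp add: double_star_def)
      then show ?thesis using n by simp
    qed (use d in auto)
    then show ?thesis using small by blast
  next
    case 3
    show ?thesis
    proof (rule score_le_two_star_value[OF P C n])
      fix u v
      have "2 * deg C u \<le> n + 4"
        using 3(2)[unfolded capped_def, rule_format, of u] by (simp add: capped_at_def)
      then show "2 * deg C u \<le> n + 5" by simp
      assume uv: "u \<noteq> v" "3 \<le> deg C u" "3 \<le> deg C v"
      have leaf: "nbrs C z = {u}" if "{u, z} \<in> C" for z using nbrs_leaf[OF P C that uv(2)] .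
      have leaf': "nbrs C z = {v}" if "{v, z} \<in> C" for z using nbrs_leaf[OF P C that uv(3)] .
      \<comment> \<open>\<open>C\<close> is one of its own admissible extensions in
        \<open>safe\<close>. The resulting vertex \<open>x\<close> outside both stars accounts for
        the 3 in place of 2 in the count below.\<close>
      have "\<not> two_stars n C u v" using 3(1) C P disj by (simp add: safe_def)
      then obtain x where x: "x < n" "x \<noteq> u" "x \<noteq> v" "{u, x} \<notin> C" "{v, x} \<notin> C"
        using uv by (auto simp: two_stars_def)
      have sub: "nbrs C u \<subseteq> {..<n} - {u}" "nbrs C v \<subseteq> {..<n} - {v}"
        using nbrs_subset[OF C] by blast+
      obtain a where a: "{u, a} \<in> C" using ex_nbr_avoiding[of "{}" C u] uv by auto
      obtain b where b: "{v, b} \<in> C" using ex_nbr_avoiding[of "{}" C v] uv by auto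
      have lt: "u < n" "v < n" using edge_on(1)[OF C] a b by blast+
      have nadj: "{u, v} \<notin> C" "{v, u} \<notin> C"
        using leaf[of v] leaf'[of u] uv(2,3) by (auto simp: deg_def)
      have "nbrs C u \<inter> nbrs C v = {}"
      proof (rule ccontr)
        assume "nbrs C u \<inter> nbrs C v \<noteq> {}"
        then obtain z where "{u, z} \<in> C" "{v, z} \<in> C" by auto
        then show False using leaf[of z] leaf'[of z] uv(1) by simp
      qed
      moreover have "u \<notin> nbrs C u \<union> nbrs C v" "v \<notin> nbrs C u \<union> nbrs C v" "x \<notin> nbrs C u \<union> nbrs C v"
        using sub nadj x unfolding nbrs_def by blast+
      ultimately have "card (insert u (insert v (insert x (nbrs C u \<union> nbrs C v)))) =
          deg C u + deg C v + 3"
        using finite_nbrs[OF C, of u] finite_nbrs[OF C, of v] uv(1) x(2,3)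
        by (simp add: card_Un_disjoint deg_def del: mem_nbrs)
      moreover have "insert u (insert v (insert x (nbrs C u \<union> nbrs C v))) \<subseteq> {..<n}"
        using sub lt x(1) by auto
      ultimately have "deg C u + deg C v + 3 \<le> n"
        using card_mono[OF finite_lessThan] by (metis card_lessThan)
      then show "2 * deg C u < n \<or> deg C u + deg C v + 3 \<le> n" by blast
    qed
  next
    case 4
    then show ?thesis using small by blast
  qed
qed

theorem constructor_blocker_le:
  assumes n: "100 \<le> n"
  shows "constructor_blocker n (path_graph 3) (path_graph 4) \<le> two_star_value n"
  unfolding constructor_blocker_def
proof (rule constructor_value_leI[where
      I = "\<lambda>C B. C \<subseteq> nsets {..<n} 2 \<and> P4_free C \<and> C \<inter> B = {} \<and> blocker_pos n C B"])
  have "capped 1 n {} {}"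
    using n unfolding capped_def by (intro allI capped_at_small) (auto simp: deg_def nbrs_def)
  then have "blocker_pos n {} {}"
    by (auto simp: blocker_pos_def at_most_one_star_def deg_def nbrs_def)
  then show "{} \<subseteq> nsets {..<n} 2 \<and> P4_free {} \<and> {} \<inter> {} = {} \<and> blocker_pos n {} {}"
    by (simp add: P4_free_def)
next
  fix C B :: "nat set set"
  assume I: "C \<subseteq> nsets {..<n} 2 \<and> P4_free C \<and> C \<inter> B = {} \<and> blocker_pos n C B"
  then show "score n (path_graph 3) C \<le> two_star_value n"
    using blocker_pos_score n by blast
  show "C \<subseteq> nsets {..<n} 2 \<and> P4_free C \<and> C \<inter> insert f B = {} \<and> blocker_pos n C (insert f B)"
    if "f \<in> unclaimed n C B" for f
    using I that blocker_pos_mono[of n C B "insert f B"] by (auto simp: unclaimed_iff)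
  fix e assume "e \<in> constructor_moves n (path_graph 4) C B"
  then have e: "e \<in> unclaimed n C B" "P4_free (insert e C)"
    using constructor_moves_P4_iff I by auto
  then have C: "insert e C \<subseteq> nsets {..<n} 2" "insert e C \<inter> B = {}"
    using I by (auto simp: unclaimed_iff)
  have "blocker_pos n (insert e C) B \<or>
    (\<exists>f\<in>unclaimed n (insert e C) B. blocker_pos n (insert e C) (insert f B))"
    using blocker_pos_step[OF C(1) e(2) n] e(1) I by (simp add: unclaimed_iff)
  then show "(insert e C \<subseteq> nsets {..<n} 2 \<and> P4_free (insert e C) \<and> insert e C \<inter> B = {} \<and>
      blocker_pos n (insert e C) B) \<or>
    (\<exists>f\<in>unclaimed n (insert e C) B. insert e C \<subseteq> nsets {..<n} 2 \<and> P4_free (insert e C) \<and>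
      insert e C \<inter> insert f B = {} \<and> blocker_pos n (insert e C) (insert f B))"
    using C e(2) by (auto simp: unclaimed_iff)
qed

theorem theorem1p3:
  shows "\<exists>n0::nat. \<forall>n\<ge>n0.
    constructor_blocker n (path_graph 3) (path_graph 4) =
      (nat \<lfloor>(real n - 2) / 2\<rfloor> choose 2) + (nat \<lceil>(real n - 2) / 2\<rceil> choose 2)"
proof (intro exI[of _ 100] allI impI)
  \<comment> \<open>The threshold 100 gives room for the quadratic estimates of the upper bound; the
    lower bound holds from 4 on.\<close>
  fix n :: nat assume n: "100 \<le> n"
  then have "constructor_blocker n (path_graph 3) (path_graph 4) = two_star_value n"
    using constructor_blocker_ge[of n] constructor_blocker_le[OF n] by simp
  then show "constructor_blocker n (path_graph 3) (path_graph 4) =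
      (nat \<lfloor>(real n - 2) / 2\<rfloor> choose 2) + (nat \<lceil>(real n - 2) / 2\<rceil> choose 2)"
    using two_star_value_eq[of n] n by simp
qed

end
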